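(* The function $I_2(n)$ has a double-exponential lower bound, that is, there is $\rho>1$ such that $I_2(n)\ge\rho^{\rho^n}$ for all sufficiently large $n$ (and hence the same is true for $I_k(n)$ for any fixed $k\ge 2$).
   Context: For an integer $k\ge 2$ and $n\ge 1$, $I_k(n)$ is the number of isomorphism types of groups given by presentations $\langle a_1,\dots,a_k\mid R\rangle$, where $R$ is an arbitrary subset of the ball of radius $n$ (with respect to word length in the free basis $a_1,\dots,a_k$) in the free group $F(a_1,\dots,a_k)$. *)

theory Defs
  imports Complex_Main "HOL-Algebra.Algebra"
begin

section \<open>Free groups of finite rank\<close>

text \<open>The letter \<open>(i, True)\<close> stands for the generator $a_i$, the letter \<open>(i, False)\<close> for its
  inverse. The elements of the free group are the freely reduced words, so that the word length of
  an element with respect to the free basis is the length of the list.\<close>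

type_synonym letter = "nat \<times> bool"

definition inv_letter :: "letter \<Rightarrow> letter" where
  "inv_letter x = (fst x, \<not> snd x)"

definition reduced :: "letter list \<Rightarrow> bool" where
  "reduced w \<longleftrightarrow> successively (\<lambda>x y. y \<noteq> inv_letter x) w"

fun cons_red :: "letter \<Rightarrow> letter list \<Rightarrow> letter list" where
  "cons_red x [] = [x]"
| "cons_red x (y # w) = (if y = inv_letter x then w else x # y # w)"

text \<open>\<open>reduce w\<close> is the freely reduced form of \<open>w\<close>: the letters of \<open>w\<close> are prepended from right
  to left to a word that is kept reduced.\<close>

definition reduce :: "letter list \<Rightarrow> letter list" where
  "reduce w = foldr cons_red w []"

definition free_group :: "nat \<Rightarrow> letter list monoid" where
  "free_group k =
     \<lparr>carrier = {w. set w \<subseteq> {1..k} \<times> UNIV \<and> reduced w},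
      monoid.mult = (\<lambda>u v. reduce (u @ v)),
      monoid.one = []\<rparr>"

definition free_ball :: "nat \<Rightarrow> nat \<Rightarrow> letter list set" where
  "free_ball k n = {w \<in> carrier (free_group k). length w \<le> n}"

lemma inv_letter_inv [simp]: "inv_letter (inv_letter x) = x"
  by (simp add: inv_letter_def)

lemma inv_letter_eq_iff: "y = inv_letter x \<longleftrightarrow> x = inv_letter y"
  by (auto simp: inv_letter_def)

lemma reduced_Nil [simp]: "reduced []"
  by (simp add: reduced_def)

lemma reduced_ConsD: "reduced (x # w) \<Longrightarrow> reduced w"
  by (cases w) (auto simp: reduced_def)

lemma reduced_cons_red: "reduced w \<Longrightarrow> reduced (cons_red x w)"
  by (cases w) (auto simp: reduced_def successively_Cons)

lemma cons_red_reduced: "reduced (x # w) \<Longrightarrow> cons_red x w = x # w"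
  by (cases w) (auto simp: reduced_def)

lemma cons_red_cancel: "reduced w \<Longrightarrow> cons_red x (cons_red (inv_letter x) w) = w"
  by (cases w) (auto simp: cons_red_reduced)

lemma set_cons_red: "set (cons_red x w) \<subseteq> insert x (set w)"
  by (cases w) auto

lemma reduced_foldr: "reduced v \<Longrightarrow> reduced (foldr cons_red u v)"
  by (induction u) (auto intro: reduced_cons_red)

lemma set_foldr: "set (foldr cons_red u v) \<subseteq> set u \<union> set v"
  by (induction u) (use set_cons_red in fastforce)+

lemma reduce_reduced: "reduced w \<Longrightarrow> reduce w = w"
  unfolding reduce_def
proof (induction w)
  case (Cons x w)
  then show ?case
    using reduced_ConsD[OF Cons.prems] by (simp add: cons_red_reduced)
qed simp

lemma reduce_append: "reduced v \<Longrightarrow> reduce (u @ v) = foldr cons_red u v"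
  using reduce_reduced[of v] by (simp add: reduce_def)

lemma foldr_cons_red:
  assumes "reduced w"
  shows "foldr cons_red (cons_red x u) w = cons_red x (foldr cons_red u w)"
  using assms cons_red_cancel[OF reduced_foldr[OF assms], of x]
  by (cases u) auto

lemma foldr_foldr:
  assumes "reduced w"
  shows "foldr cons_red (foldr cons_red u v) w = foldr cons_red u (foldr cons_red v w)"
  using assms by (induction u) (auto simp: foldr_cons_red)

lemma foldr_inverse:
  "reduced w \<Longrightarrow> foldr cons_red (rev (map inv_letter u)) (foldr cons_red u w) = w"
proof (induction u arbitrary: w)
  case (Cons x u)
  have "cons_red (inv_letter x) (cons_red x (foldr cons_red u w)) = foldr cons_red u w"
    using cons_red_cancel[OF reduced_foldr[OF Cons.prems], of "inv_letter x"] by simp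
  with Cons show ?case by simp
qed simp

lemma group_free_group: "group (free_group k)"
proof (rule groupI)
  fix u v assume uv: "u \<in> carrier (free_group k)" "v \<in> carrier (free_group k)"
  then show "u \<otimes>\<^bsub>free_group k\<^esub> v \<in> carrier (free_group k)"
    using set_foldr[of u v] by (auto simp: free_group_def reduce_append intro: reduced_foldr)
  fix w assume "w \<in> carrier (free_group k)"
  with uv show "u \<otimes>\<^bsub>free_group k\<^esub> v \<otimes>\<^bsub>free_group k\<^esub> w
      = u \<otimes>\<^bsub>free_group k\<^esub> (v \<otimes>\<^bsub>free_group k\<^esub> w)"
    by (simp add: free_group_def reduce_append reduced_foldr foldr_foldr)
next
  show "\<one>\<^bsub>free_group k\<^esub> \<in> carrier (free_group k)"
    by (simp add: free_group_def)
next
  fix u assume u: "u \<in> carrier (free_group k)"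
  then show "\<one>\<^bsub>free_group k\<^esub> \<otimes>\<^bsub>free_group k\<^esub> u = u"
    by (simp add: free_group_def reduce_reduced)
  let ?v = "reduce (rev (map inv_letter u))"
  have "?v \<in> carrier (free_group k)"
    using u set_foldr[of "rev (map inv_letter u)" "[]"]
    by (fastforce simp: free_group_def reduce_def inv_letter_def intro: reduced_foldr)
  moreover have "?v \<otimes>\<^bsub>free_group k\<^esub> u = \<one>\<^bsub>free_group k\<^esub>"
    using u foldr_inverse[of "[]" u] reduce_reduced[of u]
    by (simp add: free_group_def reduce_append foldr_foldr) (simp add: reduce_def foldr_foldr)
  ultimately show "\<exists>v\<in>carrier (free_group k). v \<otimes>\<^bsub>free_group k\<^esub> u = \<one>\<^bsub>free_group k\<^esub>"
    by blast
qed

lemma finite_free_ball: "finite (free_ball k n)"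
proof (rule finite_subset)
  show "free_ball k n \<subseteq> {w. set w \<subseteq> {1..k} \<times> UNIV \<and> length w \<le> n}"
    by (auto simp: free_ball_def free_group_def)
qed (simp add: finite_lists_length_le)


section \<open>Group presentations\<close>

definition normal_closure :: "('a, 'b) monoid_scheme \<Rightarrow> 'a set \<Rightarrow> 'a set" where
  "normal_closure G R = \<Inter> {N. N \<lhd> G \<and> R \<subseteq> N}"

definition presented_group :: "nat \<Rightarrow> letter list set \<Rightarrow> letter list set monoid" where
  "presented_group k R = free_group k Mod normal_closure (free_group k) R"

lemma (in group) normal_closure_normal:
  assumes "R \<subseteq> carrier G"
  shows "normal_closure G R \<lhd> G"
proof (rule normal_invI)
  have *: "carrier G \<in> {N. N \<lhd> G \<and> R \<subseteq> N}"
    using assms normal_self by auto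
  have "subgroup (\<Inter> {N. N \<lhd> G \<and> R \<subseteq> N}) G"
    by (rule subgroups_Inter) (use * in \<open>auto dest: normal_imp_subgroup\<close>)
  then show "subgroup (normal_closure G R) G"
    by (simp add: normal_closure_def)
qed (auto simp: normal_closure_def intro: normal.inv_op_closed2)

lemma group_presented_group:
  assumes "R \<subseteq> carrier (free_group k)"
  shows "group (presented_group k R)"
  unfolding presented_group_def
  by (rule normal.factorgroup_is_group)
    (rule group.normal_closure_normal[OF group_free_group assms])


section \<open>Counting isomorphism types\<close>

definition iso_types :: "('a, 'b) monoid_scheme set \<Rightarrow> ('a, 'b) monoid_scheme set set" where
  "iso_types \<G> = \<G> // {(G, H). G \<in> \<G> \<and> H \<in> \<G> \<and> G \<cong> H}"

definition num_iso_types :: "nat \<Rightarrow> nat \<Rightarrow> nat" where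
  "num_iso_types k n = card (iso_types {presented_group k R | R. R \<subseteq> free_ball k n})"

text \<open>The isomorphism relation is indeed an equivalence here, and the cardinality is that of a
  finite set.\<close>

lemma equiv_iso:
  assumes "\<And>G. G \<in> \<G> \<Longrightarrow> group G"
  shows "equiv \<G> {(G, H). G \<in> \<G> \<and> H \<in> \<G> \<and> G \<cong> H}"
  by (rule equivI)
    (use assms in \<open>auto simp: refl_on_def iso_refl intro!: symI transI
       intro: group.iso_sym iso_trans\<close>)

lemma finite_iso_types: "finite (iso_types {presented_group k R | R. R \<subseteq> free_ball k n})"
proof -
  have "{presented_group k R | R. R \<subseteq> free_ball k n} = presented_group k ` Pow (free_ball k n)"
    by auto
  then show ?thesis
    by (simp add: iso_types_def quotient_def finite_free_ball)
qed

end

(* If F/N is a quotient of the free group F of rank 2 and S is the subgroup generated by the squares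
   of N, then every element of F/S is represented by a word whose length is at most the number of
   edges of the Cayley graph of F/N: a path through the same directed edge twice can be shortened
   modulo squares. Start with the kernel K of F -> (Z/q)^2, which has index q^2, and let A and B be
   generated by the squares of K and of A. With m = |F/A| we get log m of order q^2, all elements of
   F/A are represented by words of length O(log m), and |F/B| is at most exponential in m.

   The commutators [a^2q, h b^2q h^-1] lie in B, their lengths are O(log m) for suitable h, and about
   m/q^2 of them are independent in the elementary abelian group B/V, V = <b^2, [b, g] : b in B>,
   which is central in F/V. Independence is seen by counting, modulo 2, the pairs formed by an a-edge
   and a later b-edge of a path in the Cayley graph of F/A whose relative position lies in a given
   set. Split these commutators into two halves of size d and equate each one in the first half with
   a product of t from the second half; for a large constant t this gives more than 2^(21m)
   families of relators of length O(log m).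

   All of K, A, B, V are verbal, and two epimorphisms from F that agree modulo the image of B agree on
   B modulo the image of V. Hence a family is determined by an isomorphism with a fixed group up to
   the images of a and b modulo B, and every isomorphism type arises from at most |F/B|^2 families. *)
theory Submission
  imports Defs "HOL-Library.Z2" "HOL-Real_Asymp.Real_Asymp"
begin

section \<open>Subgroups generated by squares\<close>

definition squares :: "('a, 'b) monoid_scheme \<Rightarrow> 'a set \<Rightarrow> 'a set" where
  "squares G S = generate G ((\<lambda>x. x \<otimes>\<^bsub>G\<^esub> x) ` S)"

text \<open>In the free group of rank 2 this is the kernel of the map to (Z/q)^2. It is defined in
  every group so that epimorphisms can carry it to presented groups.\<close>

definition power_comm :: "nat \<Rightarrow> ('a, 'b) monoid_scheme \<Rightarrow> 'a set" where
  "power_comm q G = generate G ((\<lambda>x. x [^]\<^bsub>G\<^esub> q) ` carrier G \<union>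
     (\<Union>x\<in>carrier G. \<Union>y\<in>carrier G. {x \<otimes>\<^bsub>G\<^esub> y \<otimes>\<^bsub>G\<^esub> inv\<^bsub>G\<^esub> x \<otimes>\<^bsub>G\<^esub> inv\<^bsub>G\<^esub> y}))"

text \<open>For normal \<open>S\<close>, dividing by this subgroup makes the image of
  \<open>S\<close> central and elementary abelian of exponent 2.\<close>

definition central_squares :: "('a, 'b) monoid_scheme \<Rightarrow> 'a set \<Rightarrow> 'a set" where
  "central_squares G S = generate G ((\<lambda>x. x \<otimes>\<^bsub>G\<^esub> x) ` S \<union>
     (\<Union>x\<in>S. \<Union>g\<in>carrier G. {x \<otimes>\<^bsub>G\<^esub> g \<otimes>\<^bsub>G\<^esub> inv\<^bsub>G\<^esub> x \<otimes>\<^bsub>G\<^esub> inv\<^bsub>G\<^esub> g}))"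

section \<open>Normality, commutators and additive functions to Z/2\<close>

context group
begin

lemma cancel_mid [simp]:
  assumes "x \<in> carrier G" "y \<in> carrier G"
  shows "inv x \<otimes> (x \<otimes> y) = y" "x \<otimes> (inv x \<otimes> y) = y"
  using assms by (simp_all flip: m_assoc)

lemma squares_memI: "x \<in> S \<Longrightarrow> x \<otimes> x \<in> squares G S"
  unfolding squares_def by (auto intro: generate.incl)

lemma squares_mono: "S \<subseteq> Y \<Longrightarrow> squares G S \<subseteq> squares G Y"
  unfolding squares_def by (intro mono_generate) auto

lemma conj_mult:
  assumes "x \<in> carrier G" "y \<in> carrier G" "g \<in> carrier G"
  shows "g \<otimes> (x \<otimes> y) \<otimes> inv g = (g \<otimes> x \<otimes> inv g) \<otimes> (g \<otimes> y \<otimes> inv g)"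
  using assms by (simp add: m_assoc)

lemma squares_normal:
  assumes "N \<lhd> G"
  shows "squares G N \<lhd> G"
proof -
  interpret N: normal N G by fact
  show ?thesis
    unfolding squares_def
  proof (rule normal_generateI)
    fix h g assume "h \<in> (\<lambda>x. x \<otimes> x) ` N" and g: "g \<in> carrier G"
    then obtain x where x: "x \<in> N" "h = x \<otimes> x" by auto
    have "g \<otimes> h \<otimes> inv g = (g \<otimes> x \<otimes> inv g) \<otimes> (g \<otimes> x \<otimes> inv g)"
      using x g by (simp add: conj_mult)
    moreover have "g \<otimes> x \<otimes> inv g \<in> N" using x g by (simp add: N.inv_op_closed2)
    ultimately show "g \<otimes> h \<otimes> inv g \<in> (\<lambda>x. x \<otimes> x) ` N" by blast
  qed auto
qed

lemma pow_conj:
  assumes "x \<in> carrier G" "g \<in> carrier G"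
  shows "(g \<otimes> x \<otimes> inv g) [^] (n::nat) = g \<otimes> (x [^] n) \<otimes> inv g"
  using assms by (induction n) (simp_all add: m_assoc)

lemma comm_conj:
  assumes "x \<in> carrier G" "y \<in> carrier G" "g \<in> carrier G"
  shows "g \<otimes> (x \<otimes> y \<otimes> inv x \<otimes> inv y) \<otimes> inv g
    = (g \<otimes> x \<otimes> inv g) \<otimes> (g \<otimes> y \<otimes> inv g) \<otimes> inv (g \<otimes> x \<otimes> inv g) \<otimes> inv (g \<otimes> y \<otimes> inv g)"
  using assms by (simp add: m_assoc inv_mult_group)

lemma power_comm_normal: "power_comm q G \<lhd> G"
  unfolding power_comm_def
proof (rule normal_generateI)
  fix h g assume h: "h \<in> (\<lambda>x. x [^] q) ` carrier G \<union> derived_set G (carrier G)"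
    and g: "g \<in> carrier G"
  then consider x where "x \<in> carrier G" "h = x [^] q"
    | x y where "x \<in> carrier G" "y \<in> carrier G" "h = x \<otimes> y \<otimes> inv x \<otimes> inv y"
    by auto
  then show "g \<otimes> h \<otimes> inv g \<in> (\<lambda>x. x [^] q) ` carrier G \<union> derived_set G (carrier G)"
  proof cases
    case 1
    then have "g \<otimes> h \<otimes> inv g = (g \<otimes> x \<otimes> inv g) [^] q" using g by (simp add: pow_conj)
    then show ?thesis using 1 g by auto
  next
    case 2
    then show ?thesis unfolding 2(3) comm_conj[OF 2(1,2) g] using g
      by (intro UnI2 UN_I[of "g \<otimes> x \<otimes> inv g"] UN_I[of "g \<otimes> y \<otimes> inv g"]) auto
  qed
qed auto

lemma central_squares_normal:
  assumes "N \<lhd> G"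
  shows "central_squares G N \<lhd> G"
proof -
  interpret N: normal N G by fact
  show ?thesis
    unfolding central_squares_def
  proof (rule normal_generateI)
    fix h g assume h: "h \<in> (\<lambda>x. x \<otimes> x) ` N \<union> (\<Union>x\<in>N. \<Union>g\<in>carrier G. {x \<otimes> g \<otimes> inv x \<otimes> inv g})"
      and g: "g \<in> carrier G"
    then consider x where "x \<in> N" "h = x \<otimes> x"
      | x y where "x \<in> N" "y \<in> carrier G" "h = x \<otimes> y \<otimes> inv x \<otimes> inv y"
      by auto
    then show "g \<otimes> h \<otimes> inv g \<in> (\<lambda>x. x \<otimes> x) ` N \<union>
        (\<Union>x\<in>N. \<Union>g\<in>carrier G. {x \<otimes> g \<otimes> inv x \<otimes> inv g})"
    proof cases
      case 1
      then have "g \<otimes> h \<otimes> inv g = (g \<otimes> x \<otimes> inv g) \<otimes> (g \<otimes> x \<otimes> inv g)"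
        using g by (simp add: conj_mult)
      moreover have "g \<otimes> x \<otimes> inv g \<in> N" using 1 g by (simp add: N.inv_op_closed2)
      ultimately show ?thesis by blast
    next
      case 2
      then show ?thesis unfolding 2(3) comm_conj[OF N.mem_carrier[OF 2(1)] 2(2) g] using g
        by (intro UnI2 UN_I[of "g \<otimes> x \<otimes> inv g"] UN_I[of "g \<otimes> y \<otimes> inv g"])
          (auto simp: N.inv_op_closed2)
    qed
  qed auto
qed

text \<open>The identity [x, y] = x^2 (x^-1 y)^2 y^-2 writes a commutator as a product of three
  squares.\<close>

lemma comm_in_squares:
  assumes "subgroup N G" "x \<in> N" "y \<in> N"
  shows "x \<otimes> y \<otimes> inv x \<otimes> inv y \<in> squares G N"
proof -
  interpret N: subgroup N G by fact
  have sub: "subgroup (squares G N) G"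
    unfolding squares_def by (rule generate_is_subgroup) auto
  have "x \<otimes> y \<otimes> inv x \<otimes> inv y
      = (x \<otimes> x) \<otimes> ((inv x \<otimes> y) \<otimes> (inv x \<otimes> y)) \<otimes> (inv y \<otimes> inv y)"
    using assms by (simp add: m_assoc)
  also have "\<dots> \<in> squares G N"
    using assms by (intro subgroup.m_closed[OF sub] squares_memI N.m_closed N.m_inv_closed)
  finally show ?thesis .
qed

text \<open>A homomorphism to Z/2 kills squares. This is how counts modulo 2 descend to the quotient
  by \<open>squares G N\<close>.\<close>

lemma additive_vanishes_on_squares:
  fixes \<phi> :: "'a \<Rightarrow> bit"
  assumes "subgroup N G" and add: "\<And>x y. x \<in> N \<Longrightarrow> y \<in> N \<Longrightarrow> \<phi> (x \<otimes> y) = \<phi> x + \<phi> y"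
    and "x \<in> squares G N"
  shows "\<phi> x = 0"
proof -
  interpret N: subgroup N G by fact
  have dbl: "a + a = 0" for a :: bit by (cases a) auto
  have one: "\<phi> \<one> = 0" using add[of \<one> \<one>] by (cases "\<phi> \<one>") auto
  have "x \<in> N \<and> \<phi> x = 0"
    using assms(3) unfolding squares_def
  proof induction
    case (inv h)
    then obtain y where y: "y \<in> N" "h = y \<otimes> y" by auto
    have "\<phi> h + \<phi> (inv h) = 0"
      using y one add[of h "inv h"] by simp
    then show ?case using y add[of y y] by (auto simp: dbl)
  qed (auto simp: one add dbl)
  then show ?thesis ..
qed

end

section \<open>Images of these subgroups under homomorphisms\<close>

context group_hom
begin

lemma squares_img:
  assumes "S \<subseteq> carrier G"
  shows "squares H (h ` S) = h ` squares G S"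
proof -
  have "(\<lambda>x. x \<otimes>\<^bsub>H\<^esub> x) ` h ` S = h ` (\<lambda>x. x \<otimes> x) ` S"
    unfolding image_image by (rule image_cong) (use assms in auto)
  then show ?thesis
    unfolding squares_def using assms by (subst generate_img[symmetric]) auto
qed

lemma power_comm_img:
  assumes "h ` carrier G = carrier H"
  shows "power_comm q H = h ` power_comm q G"
proof -
  have "h ` ((\<lambda>x. x [^]\<^bsub>G\<^esub> q) ` carrier G \<union> derived_set G (carrier G))
      = (\<lambda>x. x [^]\<^bsub>H\<^esub> q) ` (h ` carrier G) \<union> derived_set H (h ` carrier G)"
    by (simp add: image_Un image_UN image_image hom_nat_pow)
  then show ?thesis
    unfolding power_comm_def assms
    by (subst generate_img[symmetric]) auto
qed

lemma central_squares_img: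
  assumes "h ` carrier G = carrier H" "S \<subseteq> carrier G"
  shows "central_squares H (h ` S) = h ` central_squares G S"
proof -
  have eq: "h x \<in> carrier H" "h (x \<otimes> g \<otimes> inv x \<otimes> inv g) = h x \<otimes>\<^bsub>H\<^esub> h g \<otimes>\<^bsub>H\<^esub> inv\<^bsub>H\<^esub> h x \<otimes>\<^bsub>H\<^esub> inv\<^bsub>H\<^esub> h g"
    if "x \<in> S" "g \<in> carrier G" for x g
    using that assms(2) by auto
  have "h ` ((\<lambda>x. x \<otimes> x) ` S \<union> (\<Union>x\<in>S. \<Union>g\<in>carrier G. {x \<otimes> g \<otimes> inv x \<otimes> inv g}))
     = (\<lambda>x. h (x \<otimes> x)) ` S \<union>
       (\<Union>x\<in>S. \<Union>g\<in>carrier G. {h (x \<otimes> g \<otimes> inv x \<otimes> inv g)})"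
    by (simp only: image_Un image_UN image_image image_insert image_empty)
  also have "\<dots> = (\<lambda>x. h x \<otimes>\<^bsub>H\<^esub> h x) ` S \<union>
       (\<Union>x\<in>S. \<Union>g\<in>carrier G. {h x \<otimes>\<^bsub>H\<^esub> h g \<otimes>\<^bsub>H\<^esub> inv\<^bsub>H\<^esub> h x \<otimes>\<^bsub>H\<^esub> inv\<^bsub>H\<^esub> h g})"
    using assms(2) by (intro arg_cong2[where f = "(\<union>)"] image_cong SUP_cong refl) (auto simp: eq)
  finally have "h ` ((\<lambda>x. x \<otimes> x) ` S \<union> (\<Union>x\<in>S. \<Union>g\<in>carrier G. {x \<otimes> g \<otimes> inv x \<otimes> inv g}))
     = (\<lambda>x. x \<otimes>\<^bsub>H\<^esub> x) ` (h ` S) \<union>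
       (\<Union>x\<in>h ` S. \<Union>g\<in>h ` carrier G. {x \<otimes>\<^bsub>H\<^esub> g \<otimes>\<^bsub>H\<^esub> inv\<^bsub>H\<^esub> x \<otimes>\<^bsub>H\<^esub> inv\<^bsub>H\<^esub> g})"
    by (simp only: image_image UN_simps)
  then show ?thesis
    unfolding central_squares_def assms(1)[symmetric]
    by (subst generate_img[symmetric]) (use assms(2) in \<open>auto simp: subset_iff\<close>)
qed

end

text \<open>This is where the two homomorphisms induce the same map to \<open>H\<close> modulo
  \<open>N\<close>; agreement modulo \<open>N\<close> can thus be checked on generators.\<close>

lemma hom_agree_subgroup:
  assumes "group_hom F H \<alpha>" "group_hom F H \<beta>" "N \<lhd> H"
  shows "subgroup {x \<in> carrier F. inv\<^bsub>H\<^esub> (\<alpha> x) \<otimes>\<^bsub>H\<^esub> \<beta> x \<in> N} F"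
proof -
  interpret a: group_hom F H \<alpha> by fact
  interpret b: group_hom F H \<beta> by fact
  interpret N: normal N H by fact
  show ?thesis
  proof (rule a.G.subgroupI)
    show "{x \<in> carrier F. inv\<^bsub>H\<^esub> \<alpha> x \<otimes>\<^bsub>H\<^esub> \<beta> x \<in> N} \<noteq> {}"
      by (auto intro!: exI[of _ "\<one>\<^bsub>F\<^esub>"])
  next
    fix x assume x: "x \<in> {x \<in> carrier F. inv\<^bsub>H\<^esub> \<alpha> x \<otimes>\<^bsub>H\<^esub> \<beta> x \<in> N}"
    then have "inv\<^bsub>H\<^esub> (inv\<^bsub>H\<^esub> \<alpha> x \<otimes>\<^bsub>H\<^esub> \<beta> x) \<in> N" by simp
    then have "\<alpha> x \<otimes>\<^bsub>H\<^esub> inv\<^bsub>H\<^esub> (inv\<^bsub>H\<^esub> \<alpha> x \<otimes>\<^bsub>H\<^esub> \<beta> x) \<otimes>\<^bsub>H\<^esub> inv\<^bsub>H\<^esub> \<alpha> x \<in> N"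
      using x by (intro N.inv_op_closed2) auto
    then show "inv\<^bsub>F\<^esub> x \<in> {x \<in> carrier F. inv\<^bsub>H\<^esub> \<alpha> x \<otimes>\<^bsub>H\<^esub> \<beta> x \<in> N}"
      using x by (simp add: a.H.inv_mult_group a.H.m_assoc)
  next
    fix x y assume x: "x \<in> {x \<in> carrier F. inv\<^bsub>H\<^esub> \<alpha> x \<otimes>\<^bsub>H\<^esub> \<beta> x \<in> N}"
      and y: "y \<in> {x \<in> carrier F. inv\<^bsub>H\<^esub> \<alpha> x \<otimes>\<^bsub>H\<^esub> \<beta> x \<in> N}"
    have "inv\<^bsub>H\<^esub> \<alpha> y \<otimes>\<^bsub>H\<^esub> (inv\<^bsub>H\<^esub> \<alpha> x \<otimes>\<^bsub>H\<^esub> \<beta> x) \<otimes>\<^bsub>H\<^esub> \<alpha> y \<in> N"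
      using x y by (intro N.inv_op_closed1) auto
    then have "(inv\<^bsub>H\<^esub> \<alpha> y \<otimes>\<^bsub>H\<^esub> (inv\<^bsub>H\<^esub> \<alpha> x \<otimes>\<^bsub>H\<^esub> \<beta> x) \<otimes>\<^bsub>H\<^esub> \<alpha> y) \<otimes>\<^bsub>H\<^esub> (inv\<^bsub>H\<^esub> \<alpha> y \<otimes>\<^bsub>H\<^esub> \<beta> y) \<in> N"
      by (rule N.m_closed) (use y in auto)
    then show "x \<otimes>\<^bsub>F\<^esub> y \<in> {x \<in> carrier F. inv\<^bsub>H\<^esub> \<alpha> x \<otimes>\<^bsub>H\<^esub> \<beta> x \<in> N}"
      using x y by (simp add: a.H.inv_mult_group a.H.m_assoc)
  qed auto
qed

text \<open>Two homomorphisms that agree modulo \<open>B\<close> differ, modulo \<open>central_squares H B\<close>, by a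
  homomorphism into an elementary abelian 2-group, and such a homomorphism kills all squares.\<close>

lemma hom_agree_on_squares:
  assumes "group_hom F H \<alpha>" "group_hom F H \<beta>" "B \<lhd> H"
    and agree: "\<And>x. x \<in> carrier F \<Longrightarrow> inv\<^bsub>H\<^esub> (\<alpha> x) \<otimes>\<^bsub>H\<^esub> \<beta> x \<in> B"
    and w: "w \<in> squares F (carrier F)"
  shows "inv\<^bsub>H\<^esub> (\<alpha> w) \<otimes>\<^bsub>H\<^esub> \<beta> w \<in> central_squares H B"
proof -
  interpret a: group_hom F H \<alpha> by fact
  interpret b: group_hom F H \<beta> by fact
  interpret B: normal B H by fact
  let ?V = "central_squares H B"
  have V: "?V \<lhd> H" by (rule a.H.central_squares_normal) fact
  interpret V: normal ?V H by (fact V)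
  have "inv\<^bsub>H\<^esub> (\<alpha> (x \<otimes>\<^bsub>F\<^esub> x)) \<otimes>\<^bsub>H\<^esub> \<beta> (x \<otimes>\<^bsub>F\<^esub> x) \<in> ?V" if x: "x \<in> carrier F" for x
  proof -
    define b where "b = inv\<^bsub>H\<^esub> (\<alpha> x) \<otimes>\<^bsub>H\<^esub> \<beta> x"
    have b: "b \<in> B" "b \<in> carrier H" using agree[OF x] x by (auto simp: b_def)
    have bx: "\<beta> x = \<alpha> x \<otimes>\<^bsub>H\<^esub> b" using x by (simp add: b_def)
    have a: "\<alpha> x \<in> carrier H" "inv\<^bsub>H\<^esub> (\<alpha> x) \<in> carrier H" using x by auto
    \<comment> \<open>With a = \<open>\<alpha> x\<close>, \<open>c\<close> is [b, a^-1], and c^-1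
      b^2 = a^-1 b a b is the discrepancy a^-2 (a b)^2.\<close>
    define c where "c = b \<otimes>\<^bsub>H\<^esub> inv\<^bsub>H\<^esub> (\<alpha> x) \<otimes>\<^bsub>H\<^esub> inv\<^bsub>H\<^esub> b \<otimes>\<^bsub>H\<^esub> inv\<^bsub>H\<^esub> (inv\<^bsub>H\<^esub> (\<alpha> x))"
    have "c \<in> ?V"
      unfolding central_squares_def c_def using b a
      by (intro generate.incl UnI2 UN_I[of b] UN_I[of "inv\<^bsub>H\<^esub> (\<alpha> x)"] singletonI)
    moreover have "b \<otimes>\<^bsub>H\<^esub> b \<in> ?V"
      unfolding central_squares_def using b by (intro generate.incl UnI1 imageI)
    ultimately have "inv\<^bsub>H\<^esub> c \<otimes>\<^bsub>H\<^esub> (b \<otimes>\<^bsub>H\<^esub> b) \<in> ?V"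
      by (rule V.m_closed[OF V.m_inv_closed])
    moreover have "inv\<^bsub>H\<^esub> c \<otimes>\<^bsub>H\<^esub> (b \<otimes>\<^bsub>H\<^esub> b) = inv\<^bsub>H\<^esub> (\<alpha> (x \<otimes>\<^bsub>F\<^esub> x)) \<otimes>\<^bsub>H\<^esub> \<beta> (x \<otimes>\<^bsub>F\<^esub> x)"
      unfolding c_def using x b(2) by (simp add: bx a.H.inv_mult_group a.H.m_assoc)
    ultimately show ?thesis by simp
  qed
  then have "squares F (carrier F) \<subseteq> {x \<in> carrier F. inv\<^bsub>H\<^esub> (\<alpha> x) \<otimes>\<^bsub>H\<^esub> \<beta> x \<in> ?V}"
    unfolding squares_def
    by (intro a.G.generate_subgroup_incl hom_agree_subgroup[OF assms(1,2) V]) auto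
  then show ?thesis using w by auto
qed

section \<open>Words and the free group\<close>

definition word :: "nat \<Rightarrow> letter list \<Rightarrow> bool" where
  "word k w \<longleftrightarrow> set w \<subseteq> {1..k} \<times> UNIV"

lemma word_simps [simp]:
  "word k []"
  "word k (x # w) \<longleftrightarrow> 1 \<le> fst x \<and> fst x \<le> k \<and> word k w"
  "word k (u @ v) \<longleftrightarrow> word k u \<and> word k v"
  by (auto simp: word_def mem_Times_iff)

lemma word_replicate: "word k [x] \<Longrightarrow> word k (replicate n x)"
  by (induction n) auto

definition inv_word :: "letter list \<Rightarrow> letter list" where
  "inv_word w = rev (map inv_letter w)"

lemma reduced_reduce [simp]: "reduced (reduce w)"
  by (simp add: reduce_def reduced_foldr)

lemma reduce_reduce [simp]: "reduce (reduce w) = reduce w"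
  by (simp add: reduce_reduced)

lemma reduce_append_foldr: "reduce (u @ v) = foldr cons_red u (reduce v)"
  by (simp add: reduce_def)

lemma reduce_Cons: "reduce (x # w) = cons_red x (reduce w)"
  by (simp add: reduce_def)

lemma reduce_append_right [simp]: "reduce (u @ reduce v) = reduce (u @ v)"
  by (simp add: reduce_append_foldr)

lemma reduce_append_left [simp]: "reduce (reduce u @ v) = reduce (u @ v)"
proof -
  have "foldr cons_red (reduce u) (reduce v) = foldr cons_red u (foldr cons_red [] (reduce v))"
    unfolding reduce_def[of u] by (rule foldr_foldr) simp
  then show ?thesis by (simp add: reduce_append_foldr)
qed

lemma reduce_Cons_right [simp]: "reduce (x # reduce v) = reduce (x # v)"
  by (simp add: reduce_Cons)

lemma reduce_append_cong:
  "reduce u = reduce u' \<Longrightarrow> reduce v = reduce v' \<Longrightarrow> reduce (u @ v) = reduce (u' @ v')"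
  by (metis reduce_append_left reduce_append_right)

lemma word_reduce: "word k w \<Longrightarrow> word k (reduce w)"
  using set_foldr[of w "[]"] unfolding reduce_def word_def by auto

lemma length_reduce: "length (reduce w) \<le> length w"
proof (induction w)
  case (Cons x w)
  have "length (cons_red x v) \<le> Suc (length v)" for v by (cases v) auto
  from this[of "reduce w"] Cons show ?case by (simp add: reduce_Cons)
qed (simp add: reduce_def)

lemma carrier_free_group: "carrier (free_group k) = {w. word k w \<and> reduced w}"
  by (simp add: free_group_def word_def)

lemma mult_free_group: "u \<otimes>\<^bsub>free_group k\<^esub> v = reduce (u @ v)"
  by (simp add: free_group_def)

lemma one_free_group: "\<one>\<^bsub>free_group k\<^esub> = []"
  by (simp add: free_group_def)

lemma reduce_in_carrier: "word k w \<Longrightarrow> reduce w \<in> carrier (free_group k)"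
  by (simp add: carrier_free_group word_reduce)

lemma reduce_carrier: "w \<in> carrier (free_group k) \<Longrightarrow> reduce w = w"
  by (simp add: carrier_free_group reduce_reduced)

lemma word_carrier: "w \<in> carrier (free_group k) \<Longrightarrow> word k w"
  by (simp add: carrier_free_group)

lemma reduce_mult: "reduce u \<otimes>\<^bsub>free_group k\<^esub> reduce v = reduce (u @ v)"
  by (simp add: mult_free_group)

lemma inv_word_append [simp]: "inv_word (u @ v) = inv_word v @ inv_word u"
  by (simp add: inv_word_def)

lemma inv_word_inv_word [simp]: "inv_word (inv_word w) = w"
  by (simp add: inv_word_def rev_map comp_def)

lemma length_inv_word [simp]: "length (inv_word w) = length w"
  by (simp add: inv_word_def)

lemma word_inv_word [simp]: "word k (inv_word w) \<longleftrightarrow> word k w"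
  by (force simp: word_def inv_word_def inv_letter_def)

lemma reduce_inv_word_left: "reduce (inv_word w @ w) = []"
  using foldr_inverse[of "[]" w] by (simp add: reduce_append_foldr reduce_def inv_word_def)

lemma reduce_inv_word_right: "reduce (w @ inv_word w) = []"
  using reduce_inv_word_left[of "inv_word w"] by simp

lemma inv_reduce:
  assumes "word k w"
  shows "inv\<^bsub>free_group k\<^esub> (reduce w) = reduce (inv_word w)"
  by (rule group.inv_equality[OF group_free_group])
    (use assms in \<open>simp_all add: mult_free_group one_free_group reduce_inv_word_left reduce_in_carrier\<close>)

lemma inv_free_group:
  "w \<in> carrier (free_group k) \<Longrightarrow> inv\<^bsub>free_group k\<^esub> w = reduce (inv_word w)"
  using inv_reduce[of k w] by (simp add: reduce_carrier word_carrier)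

lemma reduce_replicate:
  assumes "word k [x]"
  shows "reduce (replicate n x) = [x] [^]\<^bsub>free_group k\<^esub> n"
proof -
  interpret group "free_group k" by (rule group_free_group)
  have x: "[x] \<in> carrier (free_group k)"
    using assms by (simp add: carrier_free_group reduced_def)
  show ?thesis
  proof (induction n)
    case (Suc n)
    have "reduce (replicate (Suc n) x) = reduce (replicate n x) \<otimes>\<^bsub>free_group k\<^esub> [x]"
      by (simp add: mult_free_group replicate_append_same flip: replicate_Suc)
    then show ?case using Suc by simp
  qed (simp add: one_free_group reduce_def)
qed

text \<open>If the path of a word traverses an edge of the Cayley graph of \<open>F/N\<close> twice in the same
  direction, \<open>w = u x v x y\<close> with \<open>x v \<in> N\<close>, then \<open>u v\<^sup>-\<^sup>1 y = u (x v)\<^sup>-\<^sup>1 x y\<close> is a shorter word with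
  the same image modulo the squares of \<open>N\<close>. Hence the diameter of \<open>F/squares N\<close> is at most the
  number of edges.\<close>

lemma short_representative:
  fixes k
  defines "F \<equiv> free_group k"
  assumes N: "N \<lhd> F"
    and \<kappa>: "\<And>u v. word k u \<Longrightarrow> word k v \<Longrightarrow> \<kappa> u = \<kappa> v \<Longrightarrow> inv\<^bsub>F\<^esub> (reduce u) \<otimes>\<^bsub>F\<^esub> reduce v \<in> N"
    and C: "finite C" "\<And>u. word k u \<Longrightarrow> \<kappa> u \<in> C"
    and w: "word k w"
  shows "\<exists>w'. word k w' \<and> length w' \<le> 2 * k * card C \<and>
           inv\<^bsub>F\<^esub> (reduce w') \<otimes>\<^bsub>F\<^esub> reduce w \<in> squares F N"
  using w
proof (induction "length w" arbitrary: w rule: less_induct)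
  case less
  interpret group F unfolding F_def by (rule group_free_group)
  interpret N: normal N F by fact
  interpret S: normal "squares F N" F by (rule squares_normal) fact
  have red: "reduce v \<in> carrier F" if "word k v" for v
    using that by (simp add: F_def reduce_in_carrier)
  show ?case
  proof (cases "length w \<le> 2 * k * card C")
    case True
    then show ?thesis using less.prems red by (intro exI[of _ w]) simp
  next
    case False
    \<comment> \<open>A position is sent to the directed edge traversed there: its starting vertex
      and its letter. There are at most \<open>2 * k * card C\<close> such edges, so a longer word
      repeats one.\<close>
    let ?f = "\<lambda>i. (\<kappa> (take i w), w ! i)"
    have tw: "word k (take i w)" for i using less.prems unfolding word_def by (auto dest: in_set_takeD)
    have "?f ` {..<length w} \<subseteq> C \<times> ({1..k} \<times> UNIV)"
    proof (rule image_subsetI)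
      fix i assume "i \<in> {..<length w}"
      then have "w ! i \<in> {1..k} \<times> UNIV" using less.prems nth_mem unfolding word_def by blast
      then show "?f i \<in> C \<times> ({1..k} \<times> UNIV)" using C(2)[OF tw] by blast
    qed
    moreover have "finite (C \<times> ({1..k} \<times> (UNIV :: bool set)))" using C(1) by simp
    ultimately have "card (?f ` {..<length w}) \<le> card (C \<times> ({1..k} \<times> (UNIV :: bool set)))"
      by (rule card_mono[rotated])
    also have "\<dots> = 2 * k * card C" by (simp add: card_cartesian_product)
    finally have "card (?f ` {..<length w}) \<le> 2 * k * card C" .
    then have "\<not> inj_on ?f {..<length w}" using False card_image[of ?f "{..<length w}"] by auto
    then obtain a b where "a < length w" "b < length w" "a \<noteq> b" "?f a = ?f b"
      unfolding inj_on_def by blast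
    then have "\<exists>i j. i < j \<and> j < length w \<and> \<kappa> (take i w) = \<kappa> (take j w) \<and> w ! i = w ! j"
      by (intro exI[of _ "min a b"] exI[of _ "max a b"]) (auto simp: min_def max_def)
    then obtain i j where ij: "i < j" "j < length w" "\<kappa> (take i w) = \<kappa> (take j w)" "w ! i = w ! j"
      by blast
    define x u v y where "x = w ! i" and "u = take i w" and "v = take (j - Suc i) (drop (Suc i) w)"
      and "y = drop (Suc j) w"
    have w1: "w = u @ x # drop (Suc i) w"
      using ij id_take_nth_drop[of i w] by (simp add: u_def x_def)
    have "drop (Suc i) w = v @ drop (j - Suc i) (drop (Suc i) w)"
      unfolding v_def by (rule append_take_drop_id[symmetric])
    also have "drop (j - Suc i) (drop (Suc i) w) = drop j w" using ij by simp
    also have "drop j w = x # y" using ij by (simp add: x_def y_def Cons_nth_drop_Suc)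
    finally have w2: "w = u @ x # v @ x # y" using w1 by simp
    have tj: "take j w = u @ x # v"
    proof -
      have "length (u @ x # v) = j" using ij by (simp add: u_def v_def)
      then show ?thesis using w2 by (metis append.assoc append_Cons append_eq_conv_conj)
    qed
    have words: "word k u" "word k v" "word k y" "word k [x]" "word k (x # v)" "word k (x # y)"
      using less.prems w2 by auto
    define U L Y where "U = reduce u" and "L = reduce (x # v)" and "Y = reduce (x # y)"
    have UL: "U \<in> carrier F" "L \<in> carrier F" "Y \<in> carrier F"
      using words by (auto simp: U_def L_def Y_def intro!: red)
    have "inv\<^bsub>F\<^esub> U \<otimes>\<^bsub>F\<^esub> reduce (u @ x # v) \<in> N"
      using \<kappa>[OF tw tw ij(3)] tj by (simp add: u_def U_def)
    also have "reduce (u @ x # v) = U \<otimes>\<^bsub>F\<^esub> L"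
      by (simp add: U_def L_def F_def reduce_mult)
    finally have L: "L \<in> N" using UL by simp
    let ?w = "u @ inv_word v @ y"
    have "reduce (inv_word v) = inv\<^bsub>F\<^esub> (reduce v)"
      using words by (simp add: F_def inv_reduce)
    moreover have "L = [x] \<otimes>\<^bsub>F\<^esub> reduce v" "Y = [x] \<otimes>\<^bsub>F\<^esub> reduce y"
      by (simp_all add: L_def Y_def F_def mult_free_group)
    moreover have "reduce ?w = U \<otimes>\<^bsub>F\<^esub> (reduce (inv_word v) \<otimes>\<^bsub>F\<^esub> reduce y)"
      by (simp add: U_def F_def mult_free_group)
    moreover have "[x] \<in> carrier F"
      using words by (simp add: F_def carrier_free_group reduced_def)
    ultimately have w': "reduce ?w = U \<otimes>\<^bsub>F\<^esub> (inv\<^bsub>F\<^esub> L \<otimes>\<^bsub>F\<^esub> Y)"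
      using red words UL by (simp add: inv_mult_group m_assoc)
    have rw: "reduce w = U \<otimes>\<^bsub>F\<^esub> (L \<otimes>\<^bsub>F\<^esub> Y)"
      using w2 by (simp add: U_def L_def Y_def F_def mult_free_group)
    have "word k ?w" using words by auto
    moreover have "length ?w < length w" by (subst w2) simp
    ultimately obtain w'' where w'': "word k w''" "length w'' \<le> 2 * k * card C"
      "inv\<^bsub>F\<^esub> (reduce w'') \<otimes>\<^bsub>F\<^esub> reduce ?w \<in> squares F N"
      using less.hyps by blast
    \<comment> \<open>The shortened word and \<open>w\<close> differ by a conjugate of the square of
      the loop \<open>L\<close>.\<close>
    have "inv\<^bsub>F\<^esub> Y \<otimes>\<^bsub>F\<^esub> (L \<otimes>\<^bsub>F\<^esub> L) \<otimes>\<^bsub>F\<^esub> Y \<in> squares F N"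
      using L UL by (intro S.inv_op_closed1 squares_memI)
    also have "inv\<^bsub>F\<^esub> Y \<otimes>\<^bsub>F\<^esub> (L \<otimes>\<^bsub>F\<^esub> L) \<otimes>\<^bsub>F\<^esub> Y = inv\<^bsub>F\<^esub> (reduce ?w) \<otimes>\<^bsub>F\<^esub> reduce w"
      unfolding w' rw using UL by (simp add: inv_mult_group m_assoc)
    finally have "(inv\<^bsub>F\<^esub> (reduce w'') \<otimes>\<^bsub>F\<^esub> reduce ?w) \<otimes>\<^bsub>F\<^esub> (inv\<^bsub>F\<^esub> (reduce ?w) \<otimes>\<^bsub>F\<^esub> reduce w) \<in> squares F N"
      by (rule S.m_closed[OF w''(3)])
    then have "inv\<^bsub>F\<^esub> (reduce w'') \<otimes>\<^bsub>F\<^esub> reduce w \<in> squares F N"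
      using red[OF w''(1)] red[OF less.prems] red[OF \<open>word k ?w\<close>] by (simp only: m_assoc cancel_mid inv_closed m_closed)
    then show ?thesis using w'' by blast
  qed
qed

section \<open>Counting edges and pairs of edges along a path\<close>

declare add_bit_eq_xor [simp del]

lemma bit_double [simp]: "a + a = (0 :: bit)" "a + (a + b) = (b :: bit)"
  by (cases a; cases b; simp add: add_bit_eq_xor)+

text \<open>The start, relative to the vertex \<open>1\<close>, of the positively oriented edge traversed by a letter,
  and its position relative to the vertex reached by the letter.\<close>

definition edge_tail :: "letter \<Rightarrow> letter list" where
  "edge_tail x = (if snd x then [] else [x])"

definition edge_back :: "letter \<Rightarrow> letter list" where
  "edge_back x = (if snd x then [x] else [])"

text \<open>Vertices of the Cayley graph are represented by words; \<open>\<rho>\<close> is summed over the tails of the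
  edges labelled \<open>2\<close> on the path \<open>w\<close> starting at \<open>p\<close>, with values modulo 2, so that the
  orientation does not matter.\<close>

fun edge_sum :: "(letter list \<Rightarrow> bit) \<Rightarrow> letter list \<Rightarrow> letter list \<Rightarrow> bit" where
  "edge_sum \<rho> p [] = 0"
| "edge_sum \<rho> p (x # w) = (if fst x = 2 then \<rho> (p @ edge_tail x) else 0) + edge_sum \<rho> (p @ [x]) w"

text \<open>The sum of \<open>\<rho> (e\<^sup>-\<^sup>1 f)\<close> over the pairs consisting of an edge \<open>e\<close> labelled \<open>1\<close> on the path \<open>u\<close>
  and an edge \<open>f\<close> labelled \<open>2\<close> on the path \<open>v\<close> that continues \<open>u\<close>; in \<open>pair_sum\<close>, over the pairs in
  which \<open>f\<close> comes after \<open>e\<close> on the path \<open>w\<close>.\<close>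

fun cross_sum :: "(letter list \<Rightarrow> bit) \<Rightarrow> letter list \<Rightarrow> letter list \<Rightarrow> bit" where
  "cross_sum \<rho> [] v = 0"
| "cross_sum \<rho> (x # u) v = (if fst x = 1 then edge_sum \<rho> (edge_back x @ u) v else 0) + cross_sum \<rho> u v"

fun pair_sum :: "(letter list \<Rightarrow> bit) \<Rightarrow> letter list \<Rightarrow> bit" where
  "pair_sum \<rho> [] = 0"
| "pair_sum \<rho> (x # w) = (if fst x = 1 then edge_sum \<rho> (edge_back x) w else 0) + pair_sum \<rho> w"

lemma edge_sum_append: "edge_sum \<rho> p (u @ v) = edge_sum \<rho> p u + edge_sum \<rho> (p @ u) v"
  by (induction u arbitrary: p) (auto simp: add.assoc)

text \<open>A pair of edges on \<open>u @ v\<close> lies in \<open>u\<close>, lies in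
  \<open>v\<close>, or has its first edge in \<open>u\<close> and its second in \<open>v\<close>.
  The last kind is the only obstruction to additivity.\<close>

lemma pair_sum_append: "pair_sum \<rho> (u @ v) = pair_sum \<rho> u + pair_sum \<rho> v + cross_sum \<rho> u v"
  by (induction u) (auto simp: edge_sum_append ac_simps)

lemma fst_inv_letter [simp]: "fst (inv_letter x) = fst x"
  by (simp add: inv_letter_def)

lemma snd_inv_letter [simp]: "snd (inv_letter x) = (\<not> snd x)"
  by (simp add: inv_letter_def)

lemma reduce_cancel [simp]:
  "reduce (p @ x # inv_letter x # t) = reduce (p @ t)"
  "reduce (p @ inv_letter x # x # t) = reduce (p @ t)"
proof -
  show *: "reduce (p @ x # inv_letter x # t) = reduce (p @ t)" for x
    by (simp add: reduce_append_foldr reduce_Cons cons_red_cancel)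
  show "reduce (p @ inv_letter x # x # t) = reduce (p @ t)"
    using *[of "inv_letter x"] by simp
qed

lemma cons_red_cases: "cons_red x w = x # w \<or> (\<exists>v. w = inv_letter x # v \<and> cons_red x w = v)"
  by (cases w) auto

section \<open>Invariance of the sums under free reduction\<close>

locale vertex_weight =
  fixes \<rho> :: "letter list \<Rightarrow> bit"
  assumes reduce_weight: "\<rho> (reduce w) = \<rho> w"
begin

lemma weight_cong: "reduce u = reduce v \<Longrightarrow> \<rho> u = \<rho> v"
  by (metis reduce_weight)

lemma edge_sum_cong:
  assumes "reduce p = reduce p'"
  shows "edge_sum \<rho> p w = edge_sum \<rho> p' w"
  using assms
proof (induction w arbitrary: p p')
  case (Cons x w)
  have "reduce (p @ v) = reduce (p' @ v)" for v
    using Cons.prems by (metis reduce_append_left)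
  then show ?case using Cons.IH[of "p @ [x]" "p' @ [x]"] weight_cong by (metis edge_sum.simps(2))
qed simp

text \<open>Backtracking traverses an edge twice with the same tail, and the two contributions
  cancel modulo 2.\<close>

lemma edge_sum_cancel: "edge_sum \<rho> p (x # inv_letter x # w) = edge_sum \<rho> p w"
proof -
  have "edge_sum \<rho> (p @ [x, inv_letter x]) w = edge_sum \<rho> p w"
    by (rule edge_sum_cong) (use reduce_cancel(1)[of p x "[]"] in simp)
  moreover have "\<rho> (p @ edge_tail x) = \<rho> (p @ x # edge_tail (inv_letter x))"
    by (rule weight_cong) (use reduce_cancel(1)[of p x "[]"] in \<open>simp add: edge_tail_def\<close>)
  ultimately show ?thesis by simp
qed

lemma edge_sum_cons_red: "edge_sum \<rho> p (cons_red x w) = edge_sum \<rho> p (x # w)"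
  using cons_red_cases[of x w] edge_sum_cancel by metis

lemma edge_sum_reduce: "edge_sum \<rho> p (reduce w) = edge_sum \<rho> p w"
  by (induction w arbitrary: p) (simp_all add: reduce_def[of "[]"] reduce_Cons edge_sum_cons_red)

lemma edge_sum_back: 
  "edge_sum \<rho> (edge_back x @ inv_letter x # u) v = edge_sum \<rho> (edge_back (inv_letter x) @ u) v"
  by (rule edge_sum_cong) (use reduce_cancel(1)[of "[]" x u] in \<open>simp add: edge_back_def\<close>)

lemma cross_sum_cancel: "cross_sum \<rho> (x # inv_letter x # u) v = cross_sum \<rho> u v"
  by (simp add: edge_sum_back)

lemma cross_sum_cons_red:
  "cross_sum \<rho> (cons_red x w) v = cross_sum \<rho> (x # w) v"
  using cons_red_cases[of x w] cross_sum_cancel by metis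

lemma cross_sum_reduce: "cross_sum \<rho> (reduce u) v = cross_sum \<rho> u v"
proof (induction u)
  case (Cons x u)
  have "edge_sum \<rho> (edge_back x @ reduce u) v = edge_sum \<rho> (edge_back x @ u) v"
    by (rule edge_sum_cong) simp
  then show ?case using Cons by (simp add: reduce_Cons cross_sum_cons_red)
qed (simp add: reduce_def)

text \<open>As first edges the two traversals pair equally with every later edge. They form no pair
  with each other, since a pair needs the labels 1 and 2.\<close>

lemma pair_sum_cancel: "pair_sum \<rho> (x # inv_letter x # w) = pair_sum \<rho> w"
  using edge_sum_back[of x "[]" w] by simp

lemma pair_sum_cons_red: "pair_sum \<rho> (cons_red x w) = pair_sum \<rho> (x # w)"
  using cons_red_cases[of x w] pair_sum_cancel by metis

lemma pair_sum_reduce: "pair_sum \<rho> (reduce w) = pair_sum \<rho> w"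
  by (induction w) (simp_all add: reduce_def[of "[]"] reduce_Cons pair_sum_cons_red edge_sum_reduce)

end

section \<open>Weights on the Cayley graph of a quotient\<close>

locale invariant_weight = vertex_weight +
  fixes k :: nat and N :: "letter list set"
  assumes normal: "N \<lhd> free_group k"
    and weight_inv: "\<And>p l t. l \<in> N \<Longrightarrow> \<rho> (p @ l @ t) = \<rho> (p @ t)"
begin

sublocale N: normal N "free_group k"
  by (fact normal)

lemma reduce_N: "w \<in> N \<Longrightarrow> reduce w = w"
  using N.mem_carrier reduce_carrier by blast

lemma edge_sum_shift:
  assumes "reduce l \<in> N"
  shows "edge_sum \<rho> (p @ l @ t) w = edge_sum \<rho> (p @ t) w"
proof -
  have "edge_sum \<rho> (p @ l @ t) w = edge_sum \<rho> (p @ reduce l @ t) w"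
    by (rule edge_sum_cong) (metis reduce_append_left reduce_append_right)
  also have "\<dots> = edge_sum \<rho> (p @ t) w"
    by (induction w arbitrary: t) (simp_all add: weight_inv[OF assms])
  finally show ?thesis .
qed

text \<open>Modulo \<open>N\<close> the path \<open>u\<close> is closed, so \<open>v\<close> starts
  again at \<open>p\<close>.\<close>

lemma edge_sum_add:
  assumes "reduce u \<in> N"
  shows "edge_sum \<rho> p (u @ v) = edge_sum \<rho> p u + edge_sum \<rho> p v"
  using edge_sum_shift[OF assms, of p "[]"] by (simp add: edge_sum_append)

lemma edge_sum_squares:
  assumes "w \<in> squares (free_group k) N"
  shows "edge_sum \<rho> p w = 0"
  by (rule group.additive_vanishes_on_squares[OF group_free_group N.subgroup_axioms _ assms])
    (simp add: mult_free_group edge_sum_reduce edge_sum_add reduce_N)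

text \<open>Appending \<open>u'\<close> moves the start of \<open>v\<close> relative to the edges of
  \<open>u\<close> by an element of \<open>N\<close>, which the weight does not see.\<close>

lemma cross_sum_add:
  assumes "reduce u' \<in> N"
  shows "cross_sum \<rho> (u @ u') v = cross_sum \<rho> u v + cross_sum \<rho> u' v"
proof (induction u)
  case (Cons x u)
  have "edge_sum \<rho> (edge_back x @ u @ u') v = edge_sum \<rho> (edge_back x @ u) v"
    using edge_sum_shift[OF assms, of "edge_back x @ u" "[]"] by simp
  then show ?case using Cons by (simp add: add.assoc)
qed simp

lemma cross_sum_squares_left:
  assumes "w \<in> squares (free_group k) N"
  shows "cross_sum \<rho> w v = 0"
  by (rule group.additive_vanishes_on_squares[OF group_free_group N.subgroup_axioms _ assms])
    (simp add: mult_free_group cross_sum_reduce cross_sum_add reduce_N)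

lemma cross_sum_squares_right:
  assumes "w \<in> squares (free_group k) N"
  shows "cross_sum \<rho> u w = 0"
  by (induction u) (simp_all add: edge_sum_squares[OF assms])

text \<open>The cross term is additive in its first path on \<open>N\<close> and depends on the
  second through edge sums, so it vanishes once either factor is a product of squares of
  \<open>N\<close>.\<close>

lemma pair_sum_add:
  assumes "reduce u \<in> squares (free_group k) N \<or> reduce v \<in> squares (free_group k) N"
  shows "pair_sum \<rho> (u @ v) = pair_sum \<rho> u + pair_sum \<rho> v"
proof -
  have "cross_sum \<rho> u v = cross_sum \<rho> u (reduce v)" for u v
    by (induction u) (simp_all add: edge_sum_reduce)
  then have "cross_sum \<rho> u v = 0"
    using assms cross_sum_squares_left[of "reduce u" v] cross_sum_squares_right[of "reduce v" u]
    by (auto simp: cross_sum_reduce)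
  then show ?thesis by (simp add: pair_sum_append)
qed

abbreviation "S \<equiv> squares (free_group k) N"

lemma S_normal: "S \<lhd> free_group k"
  by (rule group.squares_normal[OF group_free_group normal])

sublocale S: normal S "free_group k"
  by (rule S_normal)

lemma pair_sum_mult:
  assumes "u \<in> carrier (free_group k)" "v \<in> carrier (free_group k)" "u \<in> S \<or> v \<in> S"
  shows "pair_sum \<rho> (u \<otimes>\<^bsub>free_group k\<^esub> v) = pair_sum \<rho> u + pair_sum \<rho> v"
  using assms by (simp add: mult_free_group pair_sum_reduce pair_sum_add reduce_carrier)

lemma pair_sum_conj:
  assumes u: "u \<in> S" and g: "g \<in> carrier (free_group k)"
  shows "pair_sum \<rho> (g \<otimes>\<^bsub>free_group k\<^esub> u \<otimes>\<^bsub>free_group k\<^esub> inv\<^bsub>free_group k\<^esub> g) = pair_sum \<rho> u"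
proof -
  let ?c = "g \<otimes>\<^bsub>free_group k\<^esub> u \<otimes>\<^bsub>free_group k\<^esub> inv\<^bsub>free_group k\<^esub> g"
  have c: "?c \<in> S" using u g by (rule S.inv_op_closed2[rotated])
  have "pair_sum \<rho> ?c + pair_sum \<rho> g = pair_sum \<rho> (?c \<otimes>\<^bsub>free_group k\<^esub> g)"
    using pair_sum_mult[of ?c g] c g by auto
  also have "?c \<otimes>\<^bsub>free_group k\<^esub> g = g \<otimes>\<^bsub>free_group k\<^esub> u"
    using u g by (simp add: N.m_assoc)
  also have "pair_sum \<rho> \<dots> = pair_sum \<rho> g + pair_sum \<rho> u"
    using pair_sum_mult[of g u] u g by auto
  finally show ?thesis by (simp add: add.commute)
qed

lemma pair_sum_inv:
  assumes "u \<in> S"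
  shows "pair_sum \<rho> (inv\<^bsub>free_group k\<^esub> u) = pair_sum \<rho> u"
proof -
  have "pair_sum \<rho> u + pair_sum \<rho> (inv\<^bsub>free_group k\<^esub> u) = pair_sum \<rho> (u \<otimes>\<^bsub>free_group k\<^esub> inv\<^bsub>free_group k\<^esub> u)"
    using assms by (subst pair_sum_mult) auto
  also have "\<dots> = 0" using assms by (simp add: one_free_group)
  finally show ?thesis by (metis add.right_neutral bit_double(2))
qed

lemma pair_sum_kernel_normal: "{w \<in> S. pair_sum \<rho> w = 0} \<lhd> free_group k"
proof (rule group.normal_invI[OF group_free_group])
  show "subgroup {w \<in> S. pair_sum \<rho> w = 0} (free_group k)"
  proof (rule group.subgroupI[OF group_free_group])
    show "{w \<in> S. pair_sum \<rho> w = 0} \<noteq> {}"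
      using S.one_closed by (auto simp: one_free_group intro!: exI[of _ "[]"])
  qed (auto simp: pair_sum_mult pair_sum_inv)
qed (auto simp: pair_sum_conj S.inv_op_closed2)

text \<open>On \<open>S\<close> the pair sum is additive, invariant under conjugation and
  Z/2-valued, so it kills squares and commutators with any group element. It is thus a linear
  functional on \<open>S\<close> modulo \<open>central_squares\<close>, where independence is
  tested.\<close>

lemma central_squares_pair_sum:
  assumes "w \<in> central_squares (free_group k) S"
  shows "w \<in> S" "pair_sum \<rho> w = 0"
proof -
  have "central_squares (free_group k) S \<subseteq> {w \<in> S. pair_sum \<rho> w = 0}"
    unfolding central_squares_def
  proof (rule group.generate_subgroup_incl[OF group_free_group _ normal_imp_subgroup[OF pair_sum_kernel_normal]], safe)
    fix b g assume b: "b \<in> S" and g: "g \<in> carrier (free_group k)"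
    then have c: "g \<otimes>\<^bsub>free_group k\<^esub> inv\<^bsub>free_group k\<^esub> b \<otimes>\<^bsub>free_group k\<^esub> inv\<^bsub>free_group k\<^esub> g \<in> S"
      by (intro S.inv_op_closed2) auto
    have eq: "b \<otimes>\<^bsub>free_group k\<^esub> g \<otimes>\<^bsub>free_group k\<^esub> inv\<^bsub>free_group k\<^esub> b \<otimes>\<^bsub>free_group k\<^esub> inv\<^bsub>free_group k\<^esub> g
        = b \<otimes>\<^bsub>free_group k\<^esub> (g \<otimes>\<^bsub>free_group k\<^esub> inv\<^bsub>free_group k\<^esub> b \<otimes>\<^bsub>free_group k\<^esub> inv\<^bsub>free_group k\<^esub> g)"
      using b g by (simp add: N.m_assoc)
    show "b \<otimes>\<^bsub>free_group k\<^esub> g \<otimes>\<^bsub>free_group k\<^esub> inv\<^bsub>free_group k\<^esub> b \<otimes>\<^bsub>free_group k\<^esub> inv\<^bsub>free_group k\<^esub> g \<in> S"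
      unfolding eq using b c by (rule S.m_closed)
    show "pair_sum \<rho> (b \<otimes>\<^bsub>free_group k\<^esub> g \<otimes>\<^bsub>free_group k\<^esub> inv\<^bsub>free_group k\<^esub> b \<otimes>\<^bsub>free_group k\<^esub> inv\<^bsub>free_group k\<^esub> g) = 0"
      unfolding eq using b c g by (subst pair_sum_mult) (auto simp: pair_sum_conj pair_sum_inv)
  next
    fix b assume "b \<in> S"
    then show "b \<otimes>\<^bsub>free_group k\<^esub> b \<in> S" "pair_sum \<rho> (b \<otimes>\<^bsub>free_group k\<^esub> b) = 0"
      by (auto simp: pair_sum_mult)
  qed
  then show "w \<in> S" "pair_sum \<rho> w = 0" using assms by auto
qed

end

section \<open>Two layers of squares over the abelianization modulo \<open>q\<close>\<close>

lemma (in group) rcos_eq_iff: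
  assumes "N \<lhd> G" "x \<in> carrier G" "y \<in> carrier G"
  shows "N #> x = N #> y \<longleftrightarrow> inv x \<otimes> y \<in> N"
proof -
  interpret N: normal N G by fact
  have "N #> x = N #> y \<longleftrightarrow> y \<in> N #> x"
    using assms repr_independence repr_independenceD N.subgroup_axioms by metis
  also have "\<dots> \<longleftrightarrow> y \<otimes> inv x \<in> N"
    using N.rcos_module assms is_group by blast
  also have "\<dots> \<longleftrightarrow> inv x \<otimes> y \<in> N"
    using N.inv_op_closed1[of x "y \<otimes> inv x"] N.inv_op_closed2[of x "inv x \<otimes> y"] assms
    by (auto simp: m_assoc)
  finally show ?thesis .
qed

section \<open>Exponent sums\<close>

fun exp_sum :: "nat \<Rightarrow> letter list \<Rightarrow> int" where
  "exp_sum c [] = 0"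
| "exp_sum c (x # w) = (if fst x = c then if snd x then 1 else - 1 else 0) + exp_sum c w"

lemma exp_sum_append [simp]: "exp_sum c (u @ v) = exp_sum c u + exp_sum c v"
  by (induction u) auto

lemma exp_sum_replicate [simp]: "exp_sum c (replicate n x) = int n * exp_sum c [x]"
  by (induction n) (auto simp: algebra_simps)

lemma exp_sum_reduce [simp]: "exp_sum c (reduce w) = exp_sum c w"
proof (induction w)
  case (Cons x w)
  have "exp_sum c (cons_red x v) = exp_sum c (x # v)" for v
    by (cases v) (auto simp: inv_letter_def)
  then show ?case using Cons by (simp add: reduce_Cons)
qed (simp add: reduce_def)

lemma exp_sum_inv_word [simp]: "exp_sum c (inv_word w) = - exp_sum c w"
  by (induction w) (auto simp: inv_word_def)

lemma exp_sum_subgroup: "subgroup {w \<in> carrier (free_group k). d dvd exp_sum c w} (free_group k)"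
proof -
  interpret group "free_group k" by (rule group_free_group)
  show ?thesis
  proof (rule subgroupI)
    have "\<one>\<^bsub>free_group k\<^esub> \<in> {w \<in> carrier (free_group k). d dvd exp_sum c w}"
      by (simp add: one_free_group carrier_free_group)
    then show "{w \<in> carrier (free_group k). d dvd exp_sum c w} \<noteq> {}" by blast
  next
    fix w assume "w \<in> {w \<in> carrier (free_group k). d dvd exp_sum c w}"
    then show "inv\<^bsub>free_group k\<^esub> w \<in> {w \<in> carrier (free_group k). d dvd exp_sum c w}"
      by (simp add: inv_free_group reduce_in_carrier word_carrier)
  qed (auto simp: mult_free_group reduce_in_carrier word_carrier)
qed

lemma exp_sum_pow:
  "w \<in> carrier (free_group k) \<Longrightarrow> exp_sum c (w [^]\<^bsub>free_group k\<^esub> (n::nat)) = int n * exp_sum c w"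
proof (induction n)
  case 0
  interpret group "free_group k" by (rule group_free_group)
  show ?case by (simp add: one_free_group)
next
  case (Suc n)
  interpret group "free_group k" by (rule group_free_group)
  show ?case using Suc by (simp add: mult_free_group algebra_simps)
qed

lemma power_comm_exp_sum:
  assumes "w \<in> power_comm q (free_group k)"
  shows "int q dvd exp_sum c w"
proof -
  interpret group "free_group k" by (rule group_free_group)
  have "power_comm q (free_group k) \<subseteq> {w \<in> carrier (free_group k). int q dvd exp_sum c w}"
    unfolding power_comm_def
  proof (rule generate_subgroup_incl[OF _ exp_sum_subgroup], safe)
    fix x y assume "x \<in> carrier (free_group k)" "y \<in> carrier (free_group k)"
    then show "int q dvd exp_sum c (x \<otimes>\<^bsub>free_group k\<^esub> y \<otimes>\<^bsub>free_group k\<^esub> inv\<^bsub>free_group k\<^esub> x \<otimes>\<^bsub>free_group k\<^esub> inv\<^bsub>free_group k\<^esub> y)"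
      by (simp add: mult_free_group inv_free_group)
  qed (auto simp: exp_sum_pow)
  with assms show ?thesis by auto
qed

text \<open>Squaring doubles an exponent sum. For the squares of \<open>K\<close>, divisibility by q
  becomes divisibility by 2q, the order of each generator modulo \<open>A\<close>.\<close>

lemma squares_exp_sum:
  assumes N: "\<And>w. w \<in> N \<Longrightarrow> d dvd exp_sum c w" "N \<subseteq> carrier (free_group k)"
    and "w \<in> squares (free_group k) N"
  shows "2 * d dvd exp_sum c w"
proof -
  interpret group "free_group k" by (rule group_free_group)
  have "squares (free_group k) N \<subseteq> {w \<in> carrier (free_group k). 2 * d dvd exp_sum c w}"
    unfolding squares_def
  proof (rule generate_subgroup_incl[OF _ exp_sum_subgroup], safe)
    fix x assume "x \<in> N"
    then have "2 * d dvd 2 * exp_sum c x" using N by (intro mult_dvd_mono) auto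
    then show "2 * d dvd exp_sum c (x \<otimes>\<^bsub>free_group k\<^esub> x)" by (simp add: mult_free_group)
  qed (use N in auto)
  with assms show ?thesis by auto
qed

section \<open>The tower of subgroups K, A, B, V\<close>

locale mod_q =
  fixes q :: nat
  assumes q_pos: "q \<ge> 1"
begin

abbreviation F :: "letter list monoid" where "F \<equiv> free_group 2"

sublocale F: group F by (rule group_free_group)

definition K :: "letter list set" where "K = power_comm q F"
definition A :: "letter list set" where "A = squares F K"
definition B :: "letter list set" where "B = squares F A"
definition V :: "letter list set" where "V = central_squares F B"

lemma normals: "K \<lhd> F" "A \<lhd> F" "B \<lhd> F" "V \<lhd> F"
  unfolding V_def B_def A_def K_def
  by (intro F.central_squares_normal F.squares_normal F.power_comm_normal)+

sublocale K: normal K F by (rule normals)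
sublocale A: normal A F by (rule normals)
sublocale B: normal B F by (rule normals)
sublocale V: normal V F by (rule normals)

lemma exp_sum_K: "w \<in> K \<Longrightarrow> int q dvd exp_sum c w"
  unfolding K_def by (rule power_comm_exp_sum)

lemma exp_sum_A: "w \<in> A \<Longrightarrow> 2 * int q dvd exp_sum c w"
  unfolding A_def using squares_exp_sum[of K "int q"] exp_sum_K K.subset by blast

abbreviation coset :: "letter list \<Rightarrow> letter list set" where
  "coset w \<equiv> A #>\<^bsub>F\<^esub> reduce w"

lemma coset_eq: "word 2 u \<Longrightarrow> word 2 v \<Longrightarrow> coset u = coset v \<longleftrightarrow> inv\<^bsub>F\<^esub> (reduce u) \<otimes>\<^bsub>F\<^esub> reduce v \<in> A"
  by (rule F.rcos_eq_iff[OF normals(2)]) (auto intro: reduce_in_carrier)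

lemma coset_eq_iff:
  "word 2 u \<Longrightarrow> word 2 v \<Longrightarrow> coset u = coset v \<longleftrightarrow> reduce (inv_word u @ v) \<in> A"
  by (simp add: coset_eq inv_reduce reduce_mult)

lemma K_quotient_comm: "comm_group (F Mod K)"
proof (rule group.group_comm_groupI[OF K.factorgroup_is_group])
  fix C D assume "C \<in> carrier (F Mod K)" "D \<in> carrier (F Mod K)"
  then obtain x y where xy: "x \<in> carrier F" "y \<in> carrier F" "C = K #>\<^bsub>F\<^esub> x" "D = K #>\<^bsub>F\<^esub> y"
    by (auto simp: carrier_FactGroup)
  have "inv\<^bsub>F\<^esub> y \<otimes>\<^bsub>F\<^esub> inv\<^bsub>F\<^esub> x \<otimes>\<^bsub>F\<^esub> inv\<^bsub>F\<^esub> (inv\<^bsub>F\<^esub> y) \<otimes>\<^bsub>F\<^esub> inv\<^bsub>F\<^esub> (inv\<^bsub>F\<^esub> x) \<in> K"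
    unfolding K_def power_comm_def using xy
    by (intro generate.incl UnI2 UN_I[of "inv\<^bsub>F\<^esub> y"] UN_I[of "inv\<^bsub>F\<^esub> x"]) auto
  then have "K #>\<^bsub>F\<^esub> (x \<otimes>\<^bsub>F\<^esub> y) = K #>\<^bsub>F\<^esub> (y \<otimes>\<^bsub>F\<^esub> x)"
    using xy by (simp add: F.rcos_eq_iff[OF normals(1)] F.inv_mult_group F.m_assoc)
  then show "C \<otimes>\<^bsub>F Mod K\<^esub> D = D \<otimes>\<^bsub>F Mod K\<^esub> C"
    using xy by (simp add: K.rcos_sum)
qed

text \<open>The quotient by \<open>K\<close> is abelian, generated by the images of the two
  generators, and its q-th powers are trivial. So the two exponent sums modulo q determine a
  coset.\<close>

lemma K_quotient:
  assumes uv: "word 2 u" "word 2 v" and eq: "\<And>c. exp_sum c u mod int q = exp_sum c v mod int q"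
  shows "inv\<^bsub>F\<^esub> (reduce u) \<otimes>\<^bsub>F\<^esub> reduce v \<in> K"
proof -
  define H where "H = F Mod K"
  interpret H: comm_group H unfolding H_def by (rule K_quotient_comm)
  have carrier_H: "carrier H = (\<lambda>x. K #>\<^bsub>F\<^esub> x) ` carrier F"
    by (simp add: H_def carrier_FactGroup)
  define \<eta> where "\<eta> w = K #>\<^bsub>F\<^esub> reduce w" for w
  define a b where "a = \<eta> [(1, True)]" and "b = \<eta> [(2, True)]"
  have in_H: "\<eta> w \<in> carrier (H)" if "word 2 w" for w
    using that by (auto simp: \<eta>_def carrier_H reduce_in_carrier)
  have app: "\<eta> (u @ v) = \<eta> u \<otimes>\<^bsub>H\<^esub> \<eta> v" if "word 2 u" "word 2 v" for u v
    using that by (simp add: H_def \<eta>_def K.rcos_sum reduce_in_carrier reduce_mult)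
  have nil: "\<eta> [] = \<one>\<^bsub>H\<^esub>"
    using F.coset_join2[OF F.one_closed K.subgroup_axioms K.one_closed]
    by (simp add: H_def \<eta>_def reduce_def one_free_group)
  have ab: "a \<in> carrier (H)" "b \<in> carrier (H)"
    by (auto simp: a_def b_def in_H)
  have letter: "\<eta> [x] = a [^]\<^bsub>H\<^esub> exp_sum 1 [x] \<otimes>\<^bsub>H\<^esub> b [^]\<^bsub>H\<^esub> exp_sum 2 [x]"
    if x: "word 2 [x]" for x
  proof -
    have inv: "\<eta> [(c, False)] = inv\<^bsub>H\<^esub> \<eta> [(c, True)]" if c: "word 2 [(c, True)]" for c
    proof (rule H.inv_equality[symmetric])
      have "\<eta> ([(c, False)] @ [(c, True)]) = \<eta> []"
        by (simp add: \<eta>_def reduce_def inv_letter_def)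
      then show "\<eta> [(c, False)] \<otimes>\<^bsub>H\<^esub> \<eta> [(c, True)] = \<one>\<^bsub>H\<^esub>"
        using app[of "[(c, False)]" "[(c, True)]"] c nil by simp
    qed (use c in \<open>auto intro: in_H\<close>)
    have "fst x = 1 \<or> fst x = 2" using x by auto
    then show ?thesis
      using ab inv[of 1] inv[of 2] by (cases x; cases "snd x") (auto simp: a_def b_def H.int_pow_neg)
  qed
  have main: "\<eta> w = a [^]\<^bsub>H\<^esub> exp_sum 1 w \<otimes>\<^bsub>H\<^esub> b [^]\<^bsub>H\<^esub> exp_sum 2 w"
    if "word 2 w" for w
    using that
  proof (induction w)
    case (Cons x w)
    have "\<eta> (x # w) = \<eta> [x] \<otimes>\<^bsub>H\<^esub> \<eta> w" using app[of "[x]" w] Cons.prems by simp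
    then show ?case
      using Cons letter[of x] ab
      by (simp add: H.int_pow_mult[symmetric] H.m_ac del: exp_sum.simps)
        (simp add: H.int_pow_mult H.m_ac)
  qed (simp add: nil)
  have pow: "x [^]\<^bsub>H\<^esub> i = x [^]\<^bsub>H\<^esub> j" if x: "x \<in> carrier (H)" and "i mod int q = j mod int q" for x i j
  proof -
    obtain y where y: "y \<in> carrier F" "x = K #>\<^bsub>F\<^esub> y" using x by (auto simp: carrier_H)
    have "y [^]\<^bsub>F\<^esub> q \<in> K" unfolding K_def power_comm_def using y by (intro generate.incl UnI1 imageI)
    then have "x [^]\<^bsub>H\<^esub> q = \<one>\<^bsub>H\<^esub>"
      using y by (simp add: H_def K.FactGroup_pow F.coset_join2 K.subgroup_axioms)
    then have "x [^]\<^bsub>H\<^esub> int q = \<one>\<^bsub>H\<^esub>" by (simp add: int_pow_int)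
    moreover obtain d where "i = j + int q * d" using \<open>i mod int q = j mod int q\<close> 
      by (metis add.commute mod_eqE mult.commute)
    ultimately show ?thesis using x by (simp add: H.int_pow_mult flip: H.int_pow_pow)
  qed
  have "\<eta> u = \<eta> v"
    unfolding main[OF uv(1)] main[OF uv(2)] using pow[OF ab(1) eq] pow[OF ab(2) eq] by simp
  then show ?thesis
    using uv by (simp add: \<eta>_def F.rcos_eq_iff[OF normals(1)] reduce_in_carrier)
qed

text \<open>The vertices modulo \<open>K\<close> are given by pairs of exponent sums modulo q, with
  4 directed edges at each; \<open>short_representative\<close> then applies to the squares of
  \<open>K\<close>.\<close>

lemma short_rep_A:
  assumes "word 2 w"
  shows "\<exists>w'. word 2 w' \<and> length w' \<le> 4 * q\<^sup>2 \<and> coset w' = coset w"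
proof -
  let ?\<kappa> = "\<lambda>w. (exp_sum 1 w mod int q, exp_sum 2 w mod int q)"
  have other: "exp_sum c w = 0" if "word 2 w" "c \<noteq> 1" "c \<noteq> 2" for c w
    using that by (induction w) auto
  have "inv\<^bsub>F\<^esub> (reduce u) \<otimes>\<^bsub>F\<^esub> reduce v \<in> K" if "word 2 u" "word 2 v" "?\<kappa> u = ?\<kappa> v" for u v
    using that by (intro K_quotient) (metis (mono_tags) fst_conv snd_conv other)+
  moreover have "?\<kappa> u \<in> {0..<int q} \<times> {0..<int q}" for u using q_pos by auto
  ultimately obtain w' where "word 2 w'" "length w' \<le> 2 * 2 * card ({0..<int q} \<times> {0..<int q})"
      "inv\<^bsub>F\<^esub> (reduce w') \<otimes>\<^bsub>F\<^esub> reduce w \<in> squares F K"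
    using short_representative[OF normals(1), of ?\<kappa> "{0..<int q} \<times> {0..<int q}" w] assms by auto
  then show ?thesis
    using assms coset_eq[of w' w]
    by (intro exI[of _ w']) (simp add: card_cartesian_product power2_eq_square A_def)
qed

abbreviation "index_A \<equiv> card (carrier (F Mod A))"

lemma carrier_quotient_A: "carrier (F Mod A) = coset ` {w. word 2 w}"
proof -
  have "carrier F = reduce ` {w. word 2 w}"
  proof
    show "carrier F \<subseteq> reduce ` {w. word 2 w}"
      using reduce_carrier word_carrier by (metis (mono_tags) image_eqI mem_Collect_eq subsetI)
  qed (auto intro: reduce_in_carrier)
  then show ?thesis by (simp add: carrier_FactGroup image_image)
qed

lemma finite_words: "finite {w. word k w \<and> length w \<le> n}"
  unfolding word_def by (rule finite_lists_length_le) simp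

lemma finite_quotient_A: "finite (carrier (F Mod A))"
proof (rule finite_subset)
  show "carrier (F Mod A) \<subseteq> coset ` {w. word 2 w \<and> length w \<le> 4 * q\<^sup>2}"
    unfolding carrier_quotient_A using short_rep_A by (auto simp: image_iff) metis
qed (simp add: finite_words)

text \<open>The same argument one layer up, with the cosets of \<open>A\<close> as vertices.\<close>

lemma short_rep_B:
  assumes "word 2 w"
  shows "\<exists>w'. word 2 w' \<and> length w' \<le> 4 * index_A \<and> inv\<^bsub>F\<^esub> (reduce w') \<otimes>\<^bsub>F\<^esub> reduce w \<in> B"
proof -
  have "inv\<^bsub>F\<^esub> (reduce u) \<otimes>\<^bsub>F\<^esub> reduce v \<in> A" if "word 2 u" "word 2 v" "coset u = coset v" for u v
    using that coset_eq by simp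
  moreover have "coset u \<in> carrier (F Mod A)" if "word 2 u" for u
    using that by (auto simp: carrier_quotient_A)
  ultimately show ?thesis
    using short_representative[OF normals(2), of coset "carrier (F Mod A)" w] finite_quotient_A assms
    by (auto simp: B_def)
qed

end

section \<open>Retraction onto the first two generators\<close>

text \<open>This extends weights from words in two generators to all words, as
  \<open>vertex_weight\<close> requires, and it removes the further generators when the rank exceeds
  2.\<close>

definition retract :: "letter list \<Rightarrow> letter list" where
  "retract w = filter (\<lambda>x. fst x \<in> {1, 2}) w"

lemma retract_append [simp]: "retract (u @ v) = retract u @ retract v"
  by (simp add: retract_def)

lemma word_retract [simp]: "word 2 (retract w)"
  by (induction w) (auto simp: retract_def)

lemma retract_word: "word 2 w \<Longrightarrow> retract w = w"
  by (induction w) (auto simp: retract_def)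

lemma reduce_retract: "reduce (retract (reduce w)) = reduce (retract w)"
proof (induction w)
  case (Cons x w)
  have "reduce (retract (cons_red x v)) = reduce (retract (x # v))" for v
    using cons_red_cases[of x v] reduce_cancel(1)[of "[]" x]
    by (elim disjE exE conjE) (simp_all add: retract_def)
  moreover have "reduce (retract (x # reduce w)) = reduce (retract (x # w))"
  proof -
    have "reduce (retract [x] @ retract (reduce w)) = reduce (retract [x] @ retract w)"
      by (rule reduce_append_cong[OF refl Cons])
    then show ?thesis by (simp only: retract_append[symmetric] append_Cons append_Nil)
  qed
  ultimately show ?case by (simp add: reduce_Cons)
qed (simp add: reduce_def)

section \<open>A lower bound for the order of the quotient\<close>

lemma edge_sum_no_edge: "(\<And>x. x \<in> set w \<Longrightarrow> fst x \<noteq> 2) \<Longrightarrow> edge_sum \<rho> p w = 0"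
  by (induction w arbitrary: p) auto

context mod_q
begin

text \<open>The indicator of the vertex \<open>e\<close> of the torus (Z/q)^2, so that the edge sum
  counts modulo 2 how often a path traverses the edge labelled 2 with tail \<open>e\<close>.\<close>

definition grid_weight :: "nat \<times> nat \<Rightarrow> letter list \<Rightarrow> bit" where
  "grid_weight e w = of_bool (exp_sum 1 w mod int q = int (fst e) \<and> exp_sum 2 w mod int q = int (snd e))"

lemma grid_weight_invariant: "invariant_weight (grid_weight e) 2 K"
proof
  fix w show "grid_weight e (reduce w) = grid_weight e w" by (simp add: grid_weight_def)
next
  fix p l t assume "l \<in> K"
  then have "exp_sum c (p @ l @ t) mod int q = exp_sum c (p @ t) mod int q" for c
  proof -
    obtain d where "exp_sum c l = int q * d" using exp_sum_K[OF \<open>l \<in> K\<close>] by (rule dvdE)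
    then have "exp_sum c (p @ l @ t) = exp_sum c (p @ t) + int q * d" by simp
    then show ?thesis by (simp only: mod_mult_self2)
  qed
  then show "grid_weight e (p @ l @ t) = grid_weight e (p @ t)" by (simp add: grid_weight_def)
qed

text \<open>The loop through the edge labelled \<open>2\<close> at \<open>(i, j)\<close> whose other edges are edges of the
  spanning tree formed by the column \<open>i = 0\<close> and the rows.\<close>

definition grid_loop :: "nat \<times> nat \<Rightarrow> letter list" where
  "grid_loop e = replicate (snd e) (2, True) @ replicate (fst e) (1, True) @ [(2, True)] @
     replicate (fst e) (1, False) @ replicate (Suc (snd e)) (2, False)"

text \<open>Column 0 is excluded since all loops \<open>grid_loop e\<close> run along it; for
  \<open>e\<close> in \<open>grid\<close> the loop has exactly one edge labelled 2 outside that
  column.\<close>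

definition grid :: "(nat \<times> nat) set" where
  "grid = {1..<q} \<times> {0..<q}"

lemma word_grid_loop: "word 2 (grid_loop e)"
  by (simp add: grid_loop_def word_replicate del: replicate.simps)

lemma edge_sum_grid_column:
  assumes "e \<in> grid" "exp_sum 1 p mod int q = 0" "\<And>x. x \<in> set w \<Longrightarrow> fst x = 2"
  shows "edge_sum (grid_weight e) p w = 0"
  using assms(2,3)
proof (induction w arbitrary: p)
  case (Cons x w)
  have "exp_sum 1 (edge_tail x) = 0" "exp_sum 1 [x] = 0"
    using Cons.prems(2)[of x] by (auto simp: edge_tail_def)
  moreover from this have "grid_weight e (p @ edge_tail x) = 0"
    using Cons.prems(1) assms(1) by (auto simp: grid_weight_def grid_def)
  moreover have "edge_sum (grid_weight e) (p @ [x]) w = 0"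
    by (rule Cons.IH) (use Cons.prems calculation(2) in \<open>auto simp del: exp_sum.simps\<close>)
  ultimately show ?case by simp
qed simp

lemma edge_sum_grid_loop:
  assumes "e \<in> grid" "e' \<in> grid"
  shows "edge_sum (grid_weight e) [] (grid_loop e') = of_bool (e = e')"
proof -
  obtain i j where e': "e' = (i, j)" by fastforce
  let ?b = "replicate j (2 :: nat, True)" and ?a = "replicate i (1 :: nat, True)"
  let ?a' = "replicate i (1 :: nat, False)" and ?b' = "replicate (Suc j) (2 :: nat, False)"
  let ?E = "edge_sum (grid_weight e)"
  have "?E [] (grid_loop e') = ?E [] ?b + ?E ?b ?a + ?E (?b @ ?a) [(2, True)]
      + ?E (?b @ ?a @ [(2, True)]) ?a' + ?E (?b @ ?a @ [(2, True)] @ ?a') ?b'"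
    by (simp only: grid_loop_def e' fst_conv snd_conv edge_sum_append append_assoc add.assoc append_Nil)
  also have "?E [] ?b = 0" by (rule edge_sum_grid_column[OF assms(1)]) auto
  also have "?E ?b ?a = 0" by (rule edge_sum_no_edge) auto
  also have "?E (?b @ ?a @ [(2, True)]) ?a' = 0" by (rule edge_sum_no_edge) auto
  also have "?E (?b @ ?a @ [(2, True)] @ ?a') ?b' = 0"
    by (rule edge_sum_grid_column[OF assms(1)]) (auto simp del: replicate.simps)
  also have "?E (?b @ ?a) [(2, True)] = of_bool (e = e')"
    using assms by (cases e) (auto simp: grid_weight_def grid_def edge_tail_def e')
  finally show ?thesis by simp
qed

lemma grid_loop_in_K: "reduce (grid_loop e) \<in> K"
proof -
  have "inv\<^bsub>F\<^esub> (reduce []) \<otimes>\<^bsub>F\<^esub> reduce (grid_loop e) \<in> K"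
    by (rule K_quotient) (auto simp: word_grid_loop, auto simp: grid_loop_def simp del: replicate.simps)
  moreover have "inv\<^bsub>F\<^esub> (reduce []) \<otimes>\<^bsub>F\<^esub> reduce (grid_loop e) = reduce (grid_loop e)"
    using inv_reduce[of 2 "[]"] by (simp add: reduce_mult inv_word_def)
  ultimately show ?thesis by simp
qed

lemma reduce_concat_in:
  assumes "subgroup N F" "\<And>x. x \<in> set xs \<Longrightarrow> reduce (f x) \<in> N"
  shows "reduce (concat (map f xs)) \<in> N"
  using assms(2)
proof (induction xs)
  case Nil
  then show ?case using subgroup.one_closed[OF assms(1)] by (simp add: one_free_group reduce_def)
next
  case (Cons x xs)
  then have "reduce (f x) \<otimes>\<^bsub>F\<^esub> reduce (concat (map f xs)) \<in> N"
    using assms(1) by (simp add: subgroup.m_closed)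
  then show ?case by (simp add: reduce_mult)
qed

text \<open>A subset of \<open>grid\<close> is encoded by the product of its loops, an element of
  \<open>K\<close>. The edge sums recover the subset and vanish on \<open>A\<close>, so distinct
  subsets give distinct cosets of \<open>A\<close>.\<close>

lemma index_A_ge: "2 ^ ((q - 1) * q) \<le> index_A"
proof -
  define enum where "enum S = (SOME xs. set xs = S \<and> distinct xs)" for S :: "(nat \<times> nat) set"
  define w where "w S = concat (map grid_loop (enum S))" for S
  have fin: "finite grid" by (simp add: grid_def)
  have enum: "set (enum S) = S \<and> distinct (enum S)" if "S \<subseteq> grid" for S
    unfolding enum_def by (rule someI_ex) (use finite_distinct_list finite_subset[OF that fin] in blast)
  have word: "word 2 (w S)" for S
  proof -
    have "word 2 (concat (map grid_loop xs))" for xs by (induction xs) (auto simp: word_grid_loop)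
    then show ?thesis by (simp add: w_def)
  qed
  have K: "reduce (w S) \<in> K" for S
    unfolding w_def by (rule reduce_concat_in[OF K.subgroup_axioms grid_loop_in_K])
  have es: "edge_sum (grid_weight e) [] (w S) = of_bool (e \<in> S)" if e: "e \<in> grid" and S: "S \<subseteq> grid" for e S
  proof -
    interpret invariant_weight "grid_weight e" 2 K by (rule grid_weight_invariant)
    have "edge_sum (grid_weight e) [] (concat (map grid_loop xs)) = of_bool (e \<in> set xs)"
      if "distinct xs" "set xs \<subseteq> grid" for xs
      using that
    proof (induction xs)
      case (Cons x xs)
      then show ?case
        by (auto simp: edge_sum_add[OF grid_loop_in_K] edge_sum_grid_loop e)
    qed simp
    then show ?thesis using enum[OF S] S by (simp add: w_def)
  qed
  have "inj_on (\<lambda>S. coset (w S)) (Pow grid)"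
  proof (rule inj_onI)
    fix S T assume ST: "S \<in> Pow grid" "T \<in> Pow grid" and "coset (w S) = coset (w T)"
    then have A: "reduce (inv_word (w S) @ w T) \<in> squares F K"
      using coset_eq_iff word unfolding A_def by blast
    have "e \<in> S \<longleftrightarrow> e \<in> T" if e: "e \<in> grid" for e
    proof -
      interpret invariant_weight "grid_weight e" 2 K by (rule grid_weight_invariant)
      \<comment> \<open>The word reduces to \<open>w T\<close>, while its part after
        \<open>w S\<close> reduces into \<open>A\<close> and contributes 0; so \<open>w S\<close>
        and \<open>w T\<close> have equal sums.\<close>
      have "edge_sum (grid_weight e) [] (w S @ (inv_word (w S) @ w T)) = edge_sum (grid_weight e) [] (w S)"
        using edge_sum_squares[OF A] by (simp add: edge_sum_add[OF K] edge_sum_reduce)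
      moreover have "edge_sum (grid_weight e) [] (w S @ (inv_word (w S) @ w T)) = edge_sum (grid_weight e) [] (w T)"
      proof -
        have "reduce (w S @ (inv_word (w S) @ w T)) = reduce (reduce (w S @ inv_word (w S)) @ w T)"
          by simp
        also have "\<dots> = reduce (w T)" by (simp add: reduce_inv_word_right)
        finally show ?thesis by (metis edge_sum_reduce)
      qed
      ultimately have "(of_bool (e \<in> S) :: bit) = of_bool (e \<in> T)" using es e ST by simp
      then show ?thesis by (auto split: if_splits)
    qed
    then show "S = T" using ST by blast
  qed
  then have "card (Pow grid) \<le> index_A"
    by (rule card_inj_on_le) (use word in \<open>auto simp: carrier_quotient_A finite_quotient_A[unfolded carrier_quotient_A]\<close>)
  then show ?thesis using fin by (simp add: card_Pow grid_def)
qed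

end

section \<open>Commutators detected by the pair sums\<close>

lemma edge_sum_replicate: "edge_sum \<rho> p (replicate n (2, True)) = (\<Sum>j<n. \<rho> (p @ replicate j (2, True)))"
proof (induction n arbitrary: p)
  case (Suc n)
  have "edge_sum \<rho> p (replicate (Suc n) (2, True)) = \<rho> p + (\<Sum>j<n. \<rho> (p @ replicate (Suc j) (2, True)))"
    using Suc[of "p @ [(2, True)]"] by (simp add: edge_tail_def)
  then show ?case unfolding sum.lessThan_Suc_shift by simp
qed simp

text \<open>Positions are measured from the tail of the first edge. An edge followed by
  \<open>i\<close> further letters has its tail \<open>Suc i\<close> letters before the start of
  \<open>v\<close>.\<close>

lemma cross_sum_replicate:
  "cross_sum \<rho> (replicate n (1, True)) v = (\<Sum>i<n. edge_sum \<rho> (replicate (Suc i) (1, True)) v)"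
  by (induction n) (simp_all add: edge_back_def add.commute)

lemma cross_sum_no_edge: "(\<And>x. x \<in> set v \<Longrightarrow> fst x \<noteq> 2) \<Longrightarrow> cross_sum \<rho> u v = 0"
  by (induction u) (simp_all add: edge_sum_no_edge)

lemma reduce_cancel_word:
  "reduce (p @ inv_word u @ u @ t) = reduce (p @ t)"
  "reduce (p @ u @ inv_word u @ t) = reduce (p @ t)"
  using reduce_append_cong[OF refl reduce_append_cong[OF _ refl], of "inv_word u @ u" "[]" p t]
    reduce_append_cong[OF refl reduce_append_cong[OF _ refl], of "u @ inv_word u" "[]" p t]
  by (simp_all add: reduce_inv_word_left reduce_inv_word_right reduce_def[of "[]"])

context mod_q
begin

definition gen1 :: "nat \<Rightarrow> letter list" where "gen1 i = replicate i (1, True)"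
definition gen2 :: "nat \<Rightarrow> letter list" where "gen2 i = replicate i (2, True)"

definition conj_gen2 :: "letter list \<Rightarrow> letter list" where
  "conj_gen2 h = h @ gen2 (2 * q) @ inv_word h"

text \<open>The commutator of a^(2q) and h b^(2q) h^-1. The exponent 2q puts both into
  \<open>A\<close>, hence the commutator into \<open>B\<close>.\<close>

definition comm_word :: "letter list \<Rightarrow> letter list" where
  "comm_word h = gen1 (2 * q) @ conj_gen2 h @ inv_word (gen1 (2 * q)) @ inv_word (conj_gen2 h)"

lemma word_gen [simp]: "word 2 (gen1 i)" "word 2 (gen2 i)"
  by (simp_all add: gen1_def gen2_def word_replicate)

lemma word_comm_word [simp]: "word 2 h \<Longrightarrow> word 2 (comm_word h)" "word 2 h \<Longrightarrow> word 2 (conj_gen2 h)"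
  by (simp_all add: comm_word_def conj_gen2_def)

lemma length_comm_word: "length (comm_word h) = 4 * length h + 8 * q"
  by (simp add: comm_word_def conj_gen2_def gen1_def gen2_def)

lemma replicate_in_A:
  assumes "word 2 [x]"
  shows "reduce (replicate (2 * q) x) \<in> A"
proof -
  have x: "reduce [x] \<in> carrier F" using assms by (rule reduce_in_carrier)
  then have "reduce [x] [^]\<^bsub>F\<^esub> q \<in> K" unfolding K_def power_comm_def by (intro generate.incl UnI1 imageI)
  moreover have "reduce [x] [^]\<^bsub>F\<^esub> q = reduce (replicate q x)"
    using reduce_replicate[OF assms] by (simp add: reduce_def)
  ultimately have "reduce (replicate q x) \<otimes>\<^bsub>F\<^esub> reduce (replicate q x) \<in> A"
    unfolding A_def by (intro F.squares_memI) simp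
  then show ?thesis by (simp add: reduce_mult mult_2 replicate_add)
qed

lemma gen_in_A: "reduce (gen1 (2 * q)) \<in> A" "reduce (gen2 (2 * q)) \<in> A"
  unfolding gen1_def gen2_def by (auto intro!: replicate_in_A)

lemma conj_in_A: "word 2 h \<Longrightarrow> reduce (conj_gen2 h) \<in> A"
  using A.inv_op_closed2[OF reduce_in_carrier gen_in_A(2), of h]
  by (simp add: conj_gen2_def reduce_mult inv_reduce)

lemma comm_word_in_B:
  assumes "word 2 h"
  shows "reduce (comm_word h) \<in> B"
proof -
  have "reduce (gen1 (2 * q)) \<otimes>\<^bsub>F\<^esub> reduce (conj_gen2 h) \<otimes>\<^bsub>F\<^esub> inv\<^bsub>F\<^esub> reduce (gen1 (2 * q))
      \<otimes>\<^bsub>F\<^esub> inv\<^bsub>F\<^esub> reduce (conj_gen2 h) \<in> B"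
    unfolding B_def using gen_in_A(1) conj_in_A[OF assms] by (rule F.comm_in_squares[OF A.subgroup_axioms])
  then show ?thesis using assms by (simp add: comm_word_def reduce_mult inv_reduce)
qed

text \<open>The indicator of a set of vertices of the Cayley graph modulo \<open>A\<close>. The
  retraction makes it invariant also on words in other letters, over which the locale
  quantifies.\<close>

definition coset_weight :: "letter list set set \<Rightarrow> letter list \<Rightarrow> bit" where
  "coset_weight S w = of_bool (coset (retract w) \<in> S)"

lemma coset_weight_invariant: "invariant_weight (coset_weight S) 2 A"
proof
  fix w show "coset_weight S (reduce w) = coset_weight S w"
    by (simp add: coset_weight_def reduce_retract)
next
  fix p l t assume l: "l \<in> A"
  then have lc: "l \<in> carrier F" by (rule A.mem_carrier)
  then have l': "retract l = l" "word 2 l" "reduce l = l"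
    using word_carrier[OF lc] reduce_carrier[OF lc] by (auto simp: retract_word)
  have "reduce (inv_word (p @ l @ t) @ (p @ t)) = reduce (inv_word t @ inv_word l @ t)" for p t
    using reduce_cancel_word(1)[of "inv_word t @ inv_word l" p t] by simp
  moreover have "reduce (inv_word l) \<in> A"
    using A.m_inv_closed[OF l] lc by (simp add: inv_free_group)
  then have "reduce (inv_word t @ inv_word l @ t) \<in> A" if "word 2 t" for t
    using A.inv_op_closed1[of "reduce t" "inv\<^bsub>F\<^esub> l"] l l' that inv_reduce[of 2 t] inv_free_group[of l 2]
    by (simp add: reduce_in_carrier reduce_mult A.mem_carrier)
  ultimately have "coset (retract (p @ l @ t)) = coset (retract (p @ t))"
    using l' by (subst coset_eq_iff) simp_all
  then show "coset_weight S (p @ l @ t) = coset_weight S (p @ t)" by (simp add: coset_weight_def)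
qed

text \<open>Let g = a^(2q) and c = h b^(2q) h^-1, so that g c = [g, c] c g. As [g, c] lies in
  \<open>B\<close>, its pair sum is the difference of the cross terms of (g, c) and (c, g); the
  latter is 0 because g has no edge labelled 2.\<close>

lemma pair_sum_comm_word:
  assumes h: "word 2 h"
  shows "pair_sum (coset_weight S) (comm_word h)
    = (\<Sum>i<2 * q. \<Sum>j<2 * q. of_bool (coset (gen1 (Suc i) @ h @ gen2 j) \<in> S))"
proof -
  let ?\<rho> = "coset_weight S"
  interpret invariant_weight ?\<rho> 2 A by (rule coset_weight_invariant)
  let ?g = "gen1 (2 * q)" and ?c = "conj_gen2 h"
  \<comment> \<open>Since b^(2q) lies in \<open>A\<close>, the edges of h are traversed forth and
    back at the same places modulo \<open>A\<close> and cancel; only those of b^(2q) remain.\<close>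
  have shift: "edge_sum ?\<rho> p ?c = edge_sum ?\<rho> (p @ h) (gen2 (2 * q))" for p
  proof -
    have "edge_sum ?\<rho> (p @ h @ gen2 (2 * q)) (inv_word h) = edge_sum ?\<rho> (p @ h) (inv_word h)"
      using edge_sum_shift[OF gen_in_A(2), of "p @ h" "[]"] by simp
    moreover have "edge_sum ?\<rho> p h + edge_sum ?\<rho> (p @ h) (inv_word h) = 0"
      using edge_sum_append[of ?\<rho> p h "inv_word h"] edge_sum_reduce[of p "h @ inv_word h"]
      by (simp add: reduce_inv_word_right)
    ultimately show ?thesis by (simp add: conj_gen2_def edge_sum_append ac_simps)
  qed
  have "reduce (comm_word h @ ?c @ ?g) = reduce (?g @ ?c @ inv_word ?g @ ?g)"
    using reduce_cancel_word(1)[of "?g @ ?c @ inv_word ?g" ?c ?g] by (simp only: comm_word_def append_assoc)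
  also have "\<dots> = reduce (?g @ ?c)"
    using reduce_cancel_word(1)[of "?g @ ?c" ?g "[]"] by (simp only: append_assoc append_Nil2)
  finally have "pair_sum ?\<rho> (comm_word h @ ?c @ ?g) = pair_sum ?\<rho> (?g @ ?c)"
    by (metis pair_sum_reduce)
  moreover have "pair_sum ?\<rho> (comm_word h @ ?c @ ?g) = pair_sum ?\<rho> (comm_word h) + pair_sum ?\<rho> (?c @ ?g)"
    using comm_word_in_B[OF h] by (intro pair_sum_add) (simp add: B_def)
  moreover have "pair_sum ?\<rho> (?c @ ?g) = pair_sum ?\<rho> ?c + pair_sum ?\<rho> ?g"
  proof -
    have "cross_sum ?\<rho> ?c ?g = 0" by (rule cross_sum_no_edge) (auto simp: gen1_def)
    then show ?thesis by (simp add: pair_sum_append)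
  qed
  moreover have "pair_sum ?\<rho> (?g @ ?c) = pair_sum ?\<rho> ?g + pair_sum ?\<rho> ?c + cross_sum ?\<rho> ?g ?c"
    by (rule pair_sum_append)
  ultimately have "pair_sum ?\<rho> (comm_word h) = cross_sum ?\<rho> ?g ?c"
    by (metis add.assoc add.commute bit_double(2))
  also have "\<dots> = (\<Sum>i<2 * q. edge_sum ?\<rho> (gen1 (Suc i) @ h) (gen2 (2 * q)))"
    unfolding gen1_def cross_sum_replicate by (simp add: shift del: replicate.simps)
  also have "\<dots> = (\<Sum>i<2 * q. \<Sum>j<2 * q. ?\<rho> (gen1 (Suc i) @ h @ gen2 j))"
    by (simp add: gen2_def edge_sum_replicate)
  also have "\<dots> = (\<Sum>i<2 * q. \<Sum>j<2 * q. of_bool (coset (gen1 (Suc i) @ h @ gen2 j) \<in> S))"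
    using h by (intro sum.cong) (simp_all add: coset_weight_def retract_word)
  finally show ?thesis .
qed

end

section \<open>Independent commutators\<close>

context mod_q
begin

lemma coset_cong:
  assumes "word 2 u" "word 2 u'" "word 2 v" "word 2 v'" "coset u = coset u'" "coset v = coset v'"
  shows "coset (u @ v) = coset (u' @ v')"
proof -
  have "coset (u @ v) = coset u <#>\<^bsub>F\<^esub> coset v" if "word 2 u" "word 2 v" for u v
    using that by (simp add: A.rcos_sum reduce_in_carrier reduce_mult)
  then show ?thesis using assms by simp
qed

lemma gen_multiple_in_A: "reduce (gen1 (2 * q * i)) \<in> A" "reduce (gen2 (2 * q * i)) \<in> A"
proof -
  show "reduce (gen1 (2 * q * i)) \<in> A"
  proof (induction i)
    case (Suc i)
    have "gen1 (2 * q * Suc i) = gen1 (2 * q) @ gen1 (2 * q * i)" by (simp add: gen1_def flip: replicate_add)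
    then show ?case using A.m_closed[OF gen_in_A(1) Suc] by (simp add: reduce_mult)
  qed (use A.one_closed in \<open>simp add: gen1_def reduce_def one_free_group\<close>)
  show "reduce (gen2 (2 * q * i)) \<in> A"
  proof (induction i)
    case (Suc i)
    have "gen2 (2 * q * Suc i) = gen2 (2 * q) @ gen2 (2 * q * i)" by (simp add: gen2_def flip: replicate_add)
    then show ?case using A.m_closed[OF gen_in_A(2) Suc] by (simp add: reduce_mult)
  qed (use A.one_closed in \<open>simp add: gen2_def reduce_def one_free_group\<close>)
qed

lemma coset_Nil: "reduce l \<in> A \<Longrightarrow> coset l = coset []"
  using F.coset_join2[OF A.mem_carrier A.subgroup_axioms] A.one_closed
  by (simp add: reduce_def[of "[]"] one_free_group)

lemma coset_gen_mult:
  assumes "word 2 w" "coset (gen1 i @ u @ gen2 j) = coset w" "word 2 u"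
  shows "coset (gen1 (i' + i) @ u @ gen2 (j + j')) = coset (gen1 i' @ w @ gen2 j')"
proof -
  have "gen1 (i' + i) @ u @ gen2 (j + j') = gen1 i' @ (gen1 i @ u @ gen2 j) @ gen2 j'"
    by (simp add: gen1_def gen2_def replicate_add)
  then show ?thesis using assms by (simp del: append_assoc) (intro coset_cong, simp_all)
qed

lemma coset_gen_periodic:
  assumes "word 2 u"
  shows "coset (gen1 (2 * q * i' + i) @ u @ gen2 (j + 2 * q * j')) = coset (gen1 i @ u @ gen2 j)"
proof -
  have "coset (gen1 (2 * q * i' + i) @ u @ gen2 (j + 2 * q * j'))
      = coset (gen1 (2 * q * i') @ (gen1 i @ u @ gen2 j) @ gen2 (2 * q * j'))"
    by (rule coset_gen_mult) (use assms in simp_all)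
  also have "\<dots> = coset ([] @ (gen1 i @ u @ gen2 j) @ [])"
    using assms by (intro coset_cong coset_Nil gen_multiple_in_A) simp_all
  finally show ?thesis by simp
qed

section \<open>Double cosets of the two generators\<close>

definition rep :: "letter list set \<Rightarrow> letter list" where
  "rep c = (SOME w. word 2 w \<and> length w \<le> 4 * q\<^sup>2 \<and> coset w = c)"

lemma rep:
  assumes "c \<in> carrier (F Mod A)"
  shows "word 2 (rep c)" "length (rep c) \<le> 4 * q\<^sup>2" "coset (rep c) = c"
proof -
  have "\<exists>w. word 2 w \<and> length w \<le> 4 * q\<^sup>2 \<and> coset w = c"
    using assms short_rep_A unfolding carrier_quotient_A by blast
  from someI_ex[OF this] show "word 2 (rep c)" "length (rep c) \<le> 4 * q\<^sup>2" "coset (rep c) = c"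
    by (auto simp: rep_def)
qed

text \<open>The double coset of \<open>c\<close> by the cyclic groups generated by a on the left and
  b on the right. Natural exponents suffice since both have finite order modulo
  \<open>A\<close>.\<close>

definition reach :: "letter list set \<Rightarrow> letter list set set" where
  "reach c = {g. \<exists>i j. coset (gen1 i @ rep c @ gen2 j) = g}"

lemma reach_bound:
  assumes "c \<in> carrier (F Mod A)"
  shows "finite (reach c)" "card (reach c) \<le> (2 * q)\<^sup>2"
proof -
  have sub: "reach c \<subseteq> (\<lambda>(i, j). coset (gen1 i @ rep c @ gen2 j)) ` ({..<2 * q} \<times> {..<2 * q})"
  proof
    fix g assume "g \<in> reach c"
    then obtain i j where "g = coset (gen1 i @ rep c @ gen2 j)" by (auto simp: reach_def)
    then have "g = coset (gen1 (i mod (2 * q)) @ rep c @ gen2 (j mod (2 * q)))"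
      using coset_gen_periodic[OF rep(1)[OF assms], of "i div (2 * q)" "i mod (2 * q)" "j mod (2 * q)" "j div (2 * q)"]
      by simp
    then show "g \<in> (\<lambda>(i, j). coset (gen1 i @ rep c @ gen2 j)) ` ({..<2 * q} \<times> {..<2 * q})"
      using q_pos by (intro image_eqI[of _ _ "(i mod (2 * q), j mod (2 * q))"]) auto
  qed
  then show "finite (reach c)" by (rule finite_subset) simp
  have "card (reach c) \<le> card ({..<2 * q} \<times> {..<2 * q})"
    by (rule surj_card_le[OF _ sub]) simp
  then show "card (reach c) \<le> (2 * q)\<^sup>2" by (simp add: card_cartesian_product power2_eq_square)
qed

lemma reach_sym:
  assumes "c \<in> carrier (F Mod A)" "g \<in> carrier (F Mod A)" "g \<in> reach c"
  shows "c \<in> reach g"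
proof -
  obtain i j where "g = coset (gen1 i @ rep c @ gen2 j)" using assms by (auto simp: reach_def)
  then have "coset (gen1 i @ rep c @ gen2 j) = coset (rep g)" using rep assms by simp
  \<comment> \<open>The exponent \<open>2 * q * i - i\<close> is a natural number congruent to -i
    modulo 2q.\<close>
  note * = coset_gen_mult[OF _ this, of "2 * q * i - i" "2 * q * j - j"]
  have "2 * q * i - i + i = 2 * q * i" "j + (2 * q * j - j) = 2 * q * j" using q_pos by auto
  then have "coset (gen1 (2 * q * i - i) @ rep g @ gen2 (2 * q * j - j)) = coset (rep c)"
    using * rep assms coset_gen_periodic[OF rep(1)[OF assms(1)], of i 0 0 j] by (simp add: gen1_def gen2_def)
  then show ?thesis using rep assms by (auto simp: reach_def)
qed

text \<open>A maximal set with at most one element in each double coset meets all of them, and each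
  has at most (2q)^2 elements.\<close>

lemma independent_cosets:
  obtains D where "D \<subseteq> carrier (F Mod A)" "index_A \<le> card D * (2 * q)\<^sup>2"
    "\<And>c g. c \<in> D \<Longrightarrow> g \<in> D \<Longrightarrow> g \<in> reach c \<Longrightarrow> c = g"
proof -
  let ?Q = "carrier (F Mod A)"
  define \<D> where "\<D> = {D. D \<subseteq> ?Q \<and> (\<forall>c\<in>D. \<forall>g\<in>D. g \<in> reach c \<longrightarrow> c = g)}"
  have "finite \<D>" unfolding \<D>_def using finite_quotient_A by simp
  moreover have "{} \<in> \<D>" by (simp add: \<D>_def)
  ultimately obtain D where D: "D \<in> \<D>" and max: "\<And>D'. D' \<in> \<D> \<Longrightarrow> D \<subseteq> D' \<Longrightarrow> D' = D"
    using finite_has_maximal[of \<D>] by (metis empty_iff)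
  have DQ: "D \<subseteq> ?Q" using D by (simp add: \<D>_def)
  have "x \<in> (\<Union>c\<in>D. reach c)" if x: "x \<in> ?Q" for x
  proof (rule ccontr)
    assume n: "x \<notin> (\<Union>c\<in>D. reach c)"
    then have n': "g \<notin> reach x" if "g \<in> D" for g
      using reach_sym[OF x] DQ that by blast
    have "insert x D \<in> \<D>" using D n n' x by (auto simp: \<D>_def)
    then have "insert x D = D" using max by blast
    then have "x \<in> D" by blast
    moreover have "coset (gen1 0 @ rep x @ gen2 0) = x"
      using rep(3)[OF x] by (simp add: gen1_def gen2_def)
    then have "x \<in> reach x" unfolding reach_def by blast
    ultimately show False using n by blast
  qed
  then have "index_A \<le> card (\<Union>c\<in>D. reach c)"
  proof (intro card_mono)
    show "finite (\<Union>c\<in>D. reach c)"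
      using DQ finite_subset[OF DQ finite_quotient_A] reach_bound(1) by blast
  qed blast
  also have "\<dots> \<le> (\<Sum>c\<in>D. card (reach c))"
    using finite_subset[OF DQ finite_quotient_A] by (rule card_UN_le)
  also have "\<dots> \<le> card D * (2 * q)\<^sup>2"
    using sum_bounded_above[of D "\<lambda>c. card (reach c)" "(2 * q)\<^sup>2"] reach_bound(2) DQ by fastforce
  finally show ?thesis using that[of D] D by (auto simp: \<D>_def)
qed

text \<open>All vertices in the double sum lie in the double coset of \<open>c\<close>, so one lies
  in \<open>S\<close> only if it is \<open>c\<close>. Exponent sums then force 2q to divide i + 1
  and j, which leaves a single term.\<close>

lemma pair_sum_independent:
  assumes D: "D \<subseteq> carrier (F Mod A)" "\<And>c g. c \<in> D \<Longrightarrow> g \<in> D \<Longrightarrow> g \<in> reach c \<Longrightarrow> c = g"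
    and c: "c \<in> D" and S: "S \<subseteq> D"
  shows "pair_sum (coset_weight S) (comm_word (rep c)) = of_bool (c \<in> S)"
proof -
  have cQ: "c \<in> carrier (F Mod A)" using c D by blast
  note rep = rep[OF cQ]
  \<comment> \<open>The left exponent \<open>Suc i\<close> runs from 1 to 2q, so \<open>c\<close>
    itself occurs at \<open>i = 2 * q - 1\<close>.\<close>
  have iff: "coset (gen1 (Suc i) @ rep c @ gen2 j) \<in> S \<longleftrightarrow> c \<in> S \<and> i = 2 * q - 1 \<and> j = 0"
    if ij: "i < 2 * q" "j < 2 * q" for i j
  proof
    assume *: "coset (gen1 (Suc i) @ rep c @ gen2 j) \<in> S"
    have "coset (gen1 (Suc i) @ rep c @ gen2 j) \<in> reach c" unfolding reach_def by blast
    then have eq: "c = coset (gen1 (Suc i) @ rep c @ gen2 j)"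
      using D(2)[OF c] S * by blast
    then have "coset (rep c) = coset (gen1 (Suc i) @ rep c @ gen2 j)" using rep(3) by metis
    then have "reduce (inv_word (rep c) @ gen1 (Suc i) @ rep c @ gen2 j) \<in> A"
      using rep(1) by (subst (asm) coset_eq_iff) simp_all
    note exp_sum_A[OF this]
    from this[of 1] this[of 2] have "int (2 * q) dvd int (Suc i)" "int (2 * q) dvd int j"
      by (simp_all add: gen1_def gen2_def del: replicate.simps)
    then have "2 * q dvd Suc i" "2 * q dvd j"
      by (simp_all only: of_nat_dvd_iff)
    then have "j = 0" "Suc i \<ge> 2 * q" using ij by (auto dest: dvd_imp_le)
    then show "c \<in> S \<and> i = 2 * q - 1 \<and> j = 0" using eq[symmetric] * ij by simp
  next
    assume *: "c \<in> S \<and> i = 2 * q - 1 \<and> j = 0"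
    then have "coset (gen1 (Suc i) @ rep c @ gen2 j) = c"
      using coset_gen_periodic[OF rep(1), of 1 0 0 0] rep(3) q_pos
      by (simp add: gen1_def gen2_def del: replicate.simps(2))
    then show "coset (gen1 (Suc i) @ rep c @ gen2 j) \<in> S" using * by simp
  qed
  have "pair_sum (coset_weight S) (comm_word (rep c))
      = (\<Sum>i<2 * q. \<Sum>j<2 * q. if i = 2 * q - 1 then if j = 0 then of_bool (c \<in> S) else 0 else 0)"
    unfolding pair_sum_comm_word[OF rep(1)] by (intro sum.cong refl) (auto simp: iff)
  also have "\<dots> = of_bool (c \<in> S)"
    using q_pos by (subst sum.swap) simp
  finally show ?thesis .
qed

end

section \<open>Counting isomorphism types of presented groups\<close>

lemma free_group_generated:
  assumes N: "subgroup N (free_group k)" and gens: "\<And>i. i \<in> {1..k} \<Longrightarrow> [(i, True)] \<in> N"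
  shows "carrier (free_group k) \<subseteq> N"
proof
  fix w assume w: "w \<in> carrier (free_group k)"
  have letter: "[x] \<in> N" if x: "word k [x]" for x
  proof (cases "snd x")
    case True
    then show ?thesis using gens[of "fst x"] x by (metis atLeastAtMost_iff prod.collapse word_simps(2))
  next
    case False
    then have "[(fst x, True)] \<in> N" using gens[of "fst x"] x by simp
    then have "inv\<^bsub>free_group k\<^esub> [(fst x, True)] \<in> N" using N by (rule subgroup.m_inv_closed[rotated])
    moreover have "[x] = inv\<^bsub>free_group k\<^esub> (reduce [(fst x, True)])"
      using x False by (subst inv_reduce) (auto simp: inv_word_def inv_letter_def reduce_def prod_eq_iff)
    ultimately show ?thesis by (simp add: reduce_def)
  qed
  have "word k w \<Longrightarrow> reduce w \<in> N"
  proof (induction w)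
    case (Cons x w)
    then have "[x] \<otimes>\<^bsub>free_group k\<^esub> reduce w \<in> N" using letter N by (intro subgroup.m_closed) auto
    then show ?case by (simp add: mult_free_group)
  qed (use subgroup.one_closed[OF N] in \<open>simp add: one_free_group reduce_def\<close>)
  then show "w \<in> N" using w by (simp add: word_carrier reduce_carrier)
qed

lemma word_mono: "word j w \<Longrightarrow> j \<le> k \<Longrightarrow> word k w"
  by (induction w) auto

lemma free_group_mono: "j \<le> k \<Longrightarrow> carrier (free_group j) \<subseteq> carrier (free_group k)"
  by (auto simp: carrier_free_group word_mono)

definition retraction :: "letter list \<Rightarrow> letter list" where
  "retraction w = reduce (retract w)"

lemma retraction_hom: "retraction \<in> hom (free_group k) (free_group 2)"
proof (rule homI)
  fix u v
  show "retraction (u \<otimes>\<^bsub>free_group k\<^esub> v) = retraction u \<otimes>\<^bsub>free_group 2\<^esub> retraction v"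
    by (simp add: retraction_def mult_free_group reduce_retract)
qed (simp add: retraction_def reduce_in_carrier)

lemma retraction_carrier: "w \<in> carrier (free_group 2) \<Longrightarrow> retraction w = w"
  by (simp add: retraction_def retract_word word_carrier reduce_carrier)

lemma normal_preimage:
  assumes "group_hom G H h" "N \<lhd> H"
  shows "{x \<in> carrier G. h x \<in> N} \<lhd> G"
proof -
  interpret group_hom G H h by fact
  interpret N: normal N H by fact
  show ?thesis
  proof (rule G.normal_invI)
    show "subgroup {x \<in> carrier G. h x \<in> N} G"
      by (rule G.subgroupI) (auto intro!: exI[of _ "\<one>\<^bsub>G\<^esub>"])
  qed (auto simp: N.inv_op_closed2)
qed

lemma (in invariant_weight) pair_sum_concat:
  assumes "\<And>x. x \<in> set xs \<Longrightarrow> reduce (h x) \<in> S"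
  shows "pair_sum \<rho> (concat (map h xs)) = (\<Sum>x\<leftarrow>xs. pair_sum \<rho> (h x))"
  using assms by (induction xs) (simp_all add: pair_sum_add)

text \<open>\<open>C\<close> and \<open>D\<close> are two halves of a set of independent cosets.
  Each commutator from \<open>C\<close> will be equated with a product of \<open>t\<close>
  commutators from \<open>D\<close>.\<close>

locale relator_family = mod_q q for q :: nat +
  fixes k t :: nat and C D :: "letter list set set"
  assumes k: "k \<ge> 2"
    and CD: "C \<inter> D = {}" "C \<union> D \<subseteq> carrier (F Mod A)"
    and independent: "\<And>c g. c \<in> C \<union> D \<Longrightarrow> g \<in> C \<union> D \<Longrightarrow> g \<in> reach c \<Longrightarrow> c = g"
begin

definition enum :: "letter list set set \<Rightarrow> letter list set list" where
  "enum T = (SOME xs. set xs = T \<and> distinct xs)"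

text \<open>In \<open>B\<close> modulo \<open>V\<close>, a vector space over Z/2, killing this
  element equates the commutator of \<open>x\<close> with the product over \<open>T\<close>; signs
  and order do not matter there.\<close>

definition relator :: "letter list set \<Rightarrow> letter list set set \<Rightarrow> letter list" where
  "relator x T = reduce (concat (map (\<lambda>c. comm_word (rep c)) (x # enum T)))"

definition families :: "(letter list set \<Rightarrow> letter list set set) set" where
  "families = C \<rightarrow>\<^sub>E {T. T \<subseteq> D \<and> card T = t}"

text \<open>The generators of index above 2 are killed, so every presented group is a quotient of
  the free group of rank 2.\<close>

definition relators :: "(letter list set \<Rightarrow> letter list set set) \<Rightarrow> letter list set" where
  "relators f = (\<lambda>x. relator x (f x)) ` C \<union> (\<lambda>i. [(i, True)]) ` {3..k}"

lemma finite_CD: "finite C" "finite D"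
  using finite_subset[OF CD(2) finite_quotient_A] by simp_all

lemma enum:
  assumes "T \<subseteq> D"
  shows "set (enum T) = T" "distinct (enum T)" "length (enum T) = card T"
proof -
  have "\<exists>xs. set xs = T \<and> distinct xs"
    using finite_distinct_list finite_subset[OF assms finite_CD(2)] by blast
  from someI_ex[OF this] show *: "set (enum T) = T" "distinct (enum T)" by (simp_all add: enum_def)
  then show "length (enum T) = card T" using distinct_card by metis
qed

lemma relator_in_B:
  assumes "x \<in> C" "T \<subseteq> D"
  shows "relator x T \<in> B"
  unfolding relator_def
  by (rule reduce_concat_in[OF B.subgroup_axioms])
    (use assms CD(2) enum(1)[OF assms(2)] in \<open>auto intro!: comm_word_in_B rep(1)\<close>)

lemma length_relator:
  assumes "x \<in> C" "T \<subseteq> D"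
  shows "length (relator x T) \<le> (card T + 1) * (24 * q\<^sup>2)"
proof -
  \<comment> \<open>The length is 4 |h| + 8q with |h| at most 4 q^2.\<close>
  have "length (comm_word (rep c)) \<le> 24 * q\<^sup>2" if "c \<in> C \<union> D" for c
  proof -
    have "4 * length (rep c) \<le> 16 * q\<^sup>2" using rep(2)[of c] that CD(2) by auto
    moreover have "8 * q \<le> 8 * q\<^sup>2" using q_pos by (simp add: power2_eq_square)
    ultimately show ?thesis by (simp add: length_comm_word)
  qed
  then have "length (concat (map (\<lambda>c. comm_word (rep c)) xs)) \<le> length xs * (24 * q\<^sup>2)"
    if "set xs \<subseteq> C \<union> D" for xs
    using that by (induction xs) (auto intro: add_mono)
  from this[of "x # enum T"]
  have "length (concat (map (\<lambda>c. comm_word (rep c)) (x # enum T))) \<le> (card T + 1) * (24 * q\<^sup>2)"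
    using assms enum[OF assms(2)] by auto
  then show ?thesis unfolding relator_def by (rule order_trans[OF length_reduce])
qed

text \<open>Each commutator contributes the indicator of \<open>S\<close>, and \<open>y\<close> is
  the only element of \<open>D\<close> in \<open>S\<close>. So the sum tests whether
  \<open>y\<close> is in \<open>T\<close>.\<close>

lemma pair_sum_relator:
  assumes "x \<in> C" "T \<subseteq> D" "S \<subseteq> C \<union> D" "S \<inter> D = {y}"
  shows "pair_sum (coset_weight S) (relator x T) = of_bool (x \<in> S) + of_bool (y \<in> T)"
proof -
  interpret w: invariant_weight "coset_weight S" 2 A by (rule coset_weight_invariant)
  have one: "pair_sum (coset_weight S) (comm_word (rep c)) = of_bool (c \<in> S)" if "c \<in> C \<union> D" for c
    by (rule pair_sum_independent[OF CD(2) independent that assms(3)])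
  have "pair_sum (coset_weight S) (relator x T)
      = (\<Sum>c\<leftarrow>x # enum T. pair_sum (coset_weight S) (comm_word (rep c)))"
    unfolding relator_def w.pair_sum_reduce
  proof (rule w.pair_sum_concat)
    fix c assume "c \<in> set (x # enum T)"
    then have "c \<in> carrier (F Mod A)" using enum(1)[OF assms(2)] assms CD by auto
    then show "reduce (comm_word (rep c)) \<in> w.S" using comm_word_in_B[OF rep(1)] by (simp add: B_def)
  qed
  also have "\<dots> = of_bool (x \<in> S) + (\<Sum>c\<in>T. pair_sum (coset_weight S) (comm_word (rep c)))"
    using one[of x] assms(1) enum[OF assms(2)] by (simp add: sum_list_distinct_conv_sum_set)
  also have "(\<Sum>c\<in>T. pair_sum (coset_weight S) (comm_word (rep c))) = (\<Sum>c\<in>T. if c = y then 1 else 0)"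
  proof (rule sum.cong[OF refl])
    fix c assume "c \<in> T"
    then have "c \<in> C \<union> D" "c \<in> S \<longleftrightarrow> c = y" using assms by blast+
    then show "pair_sum (coset_weight S) (comm_word (rep c)) = (if c = y then 1 else 0)"
      using one[of c] by simp
  qed
  also have "\<dots> = of_bool (y \<in> T)"
    using finite_subset[OF assms(2) finite_CD(2)] by simp
  finally show ?thesis .
qed

section \<open>Presented groups as quotients of the free group of rank 2\<close>

abbreviation "Fk \<equiv> free_group k"

sublocale Fk: group Fk by (rule group_free_group)

lemma F_subset_Fk: "carrier F \<subseteq> carrier Fk"
  by (rule free_group_mono[OF k])

lemma relators_carrier: "f \<in> families \<Longrightarrow> relators f \<subseteq> carrier Fk"
proof -
  assume f: "f \<in> families"
  have "relator x (f x) \<in> carrier Fk" if "x \<in> C" for x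
  proof -
    have "f x \<subseteq> D" using f that by (auto simp: families_def)
    then show ?thesis using relator_in_B[OF that] B.mem_carrier F_subset_Fk by blast
  qed
  moreover have "[(i, True)] \<in> carrier Fk" if "i \<in> {3..k}" for i
    using that by (auto simp: carrier_free_group reduced_def)
  ultimately show "relators f \<subseteq> carrier Fk" unfolding relators_def by blast
qed

lemma relators_free_ball:
  assumes "f \<in> families" "(t + 1) * (24 * q\<^sup>2) \<le> n"
  shows "relators f \<subseteq> free_ball k n"
proof -
  have "length (relator x (f x)) \<le> n" if "x \<in> C" for x
  proof -
    have fx: "f x \<subseteq> D" "card (f x) = t" using assms(1) that by (auto simp: families_def)
    show ?thesis using length_relator[OF that fx(1)] assms(2) unfolding fx(2) by (rule order_trans)
  qed
  moreover have "1 \<le> n"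
  proof -
    have "0 < (t + 1) * (24 * q\<^sup>2)" using q_pos by simp
    then show ?thesis using assms(2) by linarith
  qed
  ultimately have "length w \<le> n" if "w \<in> relators f" for w
    using that unfolding relators_def by (elim UnE imageE) simp_all
  then show ?thesis using relators_carrier[OF assms(1)] unfolding free_ball_def by blast
qed

abbreviation "presented f \<equiv> presented_group k (relators f)"
abbreviation "kern f \<equiv> normal_closure Fk (relators f)"

definition proj :: "(letter list set \<Rightarrow> letter list set set) \<Rightarrow> letter list \<Rightarrow> letter list set" where
  "proj f w = kern f #>\<^bsub>Fk\<^esub> w"

context
  fixes f assumes f: "f \<in> families"
begin

lemma kern_normal: "kern f \<lhd> Fk"
  by (rule Fk.normal_closure_normal[OF relators_carrier[OF f]])

lemma relators_kern: "relators f \<subseteq> kern f"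
  by (auto simp: normal_closure_def)

lemma proj_hom: "group_hom F (presented f) (proj f)"
proof (intro group_hom.intro group_hom_axioms.intro)
  show "group F" by (rule group_free_group)
  show "group (presented f)" by (rule group_presented_group[OF relators_carrier[OF f]])
  have "(\<lambda>w. kern f #>\<^bsub>Fk\<^esub> w) \<in> hom Fk (presented f)"
    unfolding presented_group_def by (rule normal.r_coset_hom_Mod[OF kern_normal])
  then show "proj f \<in> hom F (presented f)"
    using F_subset_Fk by (auto simp: hom_def proj_def mult_free_group Pi_iff subset_iff)
qed

text \<open>It suffices to compare the identity with the retraction on generators: those of index at
  most 2 are fixed, the others are relators and are sent to the identity.\<close>

lemma retraction_kern:
  assumes "w \<in> carrier Fk"
  shows "inv\<^bsub>Fk\<^esub> w \<otimes>\<^bsub>Fk\<^esub> retraction w \<in> kern f"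
proof -
  have id: "group_hom Fk Fk (\<lambda>x. x)"
    by (simp add: group_hom_def group_hom_axioms_def hom_def group_free_group)
  have r: "group_hom Fk Fk retraction"
    using retraction_hom[of k] F_subset_Fk
    by (auto simp: group_hom_def group_hom_axioms_def hom_def group_free_group Pi_iff mult_free_group)
  have "carrier Fk \<subseteq> {x \<in> carrier Fk. inv\<^bsub>Fk\<^esub> x \<otimes>\<^bsub>Fk\<^esub> retraction x \<in> kern f}"
  proof (rule free_group_generated[OF hom_agree_subgroup[OF id r kern_normal]])
    fix i assume i: "i \<in> {1..k}"
    have x: "[(i, True)] \<in> carrier Fk" using i by (auto simp: carrier_free_group reduced_def)
    have N: "subgroup (kern f) Fk" using kern_normal by (rule normal_imp_subgroup)
    show "[(i, True)] \<in> {x \<in> carrier Fk. inv\<^bsub>Fk\<^esub> x \<otimes>\<^bsub>Fk\<^esub> retraction x \<in> kern f}"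
    proof (cases "i \<le> 2")
      case True
      then have "retraction [(i, True)] = [(i, True)]"
        using i by (intro retraction_carrier) (auto simp: carrier_free_group reduced_def)
      then show ?thesis using x subgroup.one_closed[OF N] by simp
    next
      case False
      then have "retraction [(i, True)] = \<one>\<^bsub>Fk\<^esub>"
        by (simp add: retraction_def retract_def reduce_def one_free_group)
      moreover have "[(i, True)] \<in> kern f"
        using relators_kern False i by (auto simp: relators_def)
      ultimately show ?thesis using x subgroup.m_inv_closed[OF N] by simp
    qed
  qed
  then show ?thesis using assms by blast
qed

lemma proj_surj: "proj f ` carrier F = carrier (presented f)"
proof
  show "proj f ` carrier F \<subseteq> carrier (presented f)"
    using group_hom.hom_closed[OF proj_hom] by auto
  show "carrier (presented f) \<subseteq> proj f ` carrier F"
  proof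
    fix c assume "c \<in> carrier (presented f)"
    then obtain w where w: "w \<in> carrier Fk" "c = kern f #>\<^bsub>Fk\<^esub> w"
      by (auto simp: presented_group_def carrier_FactGroup)
    have r: "retraction w \<in> carrier F" using retraction_hom w by (auto simp: hom_def)
    then have "c = proj f (retraction w)"
      using retraction_kern[OF w(1)] w F_subset_Fk Fk.rcos_eq_iff[OF kern_normal w(1)]
      by (auto simp: proj_def)
    then show "c \<in> proj f ` carrier F" using r by blast
  qed
qed

text \<open>A coset z in \<open>C\<close> lies in \<open>S\<close> exactly when y is in
  \<open>f z\<close>, so the two contributions to each relator cancel. Elements whose retraction
  lies in \<open>B\<close> with pair sum 0 form a normal subgroup of \<open>Fk\<close> containing
  the relators, hence the kernel.\<close>

lemma kern_pair_sum:
  assumes "y \<in> D" and w: "w \<in> kern f" "w \<in> carrier F"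
  defines "S \<equiv> insert y {x \<in> C. y \<in> f x}"
  shows "w \<in> B" "pair_sum (coset_weight S) w = 0"
proof -
  interpret w: invariant_weight "coset_weight S" 2 A by (rule coset_weight_invariant)
  let ?M = "{w \<in> w.S. pair_sum (coset_weight S) w = 0}"
  have r: "group_hom Fk F retraction"
    by (simp add: group_hom_def group_hom_axioms_def group_free_group retraction_hom)
  have N: "{x \<in> carrier Fk. retraction x \<in> ?M} \<lhd> Fk"
    by (rule normal_preimage[OF r w.pair_sum_kernel_normal])
  have "retraction x \<in> ?M" if x: "x \<in> relators f" for x
  proof -
    from x consider z where "z \<in> C" "x = relator z (f z)" | i where "i \<in> {3..k}" "x = [(i, True)]"
      by (auto simp: relators_def)
    then show ?thesis
    proof cases
      case 1
      then have fz: "f z \<subseteq> D" using f by (auto simp: families_def)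
      then have xB: "x \<in> B" using 1 relator_in_B by simp
      have "pair_sum (coset_weight S) x = of_bool (z \<in> S) + of_bool (y \<in> f z)"
        unfolding 1 by (rule pair_sum_relator) (use 1 fz CD assms(1) in \<open>auto simp: S_def\<close>)
      moreover have "z \<in> S \<longleftrightarrow> y \<in> f z" using 1 CD assms(1) by (auto simp: S_def)
      ultimately have "pair_sum (coset_weight S) x = 0" by simp
      moreover have "retraction x = x" using xB by (intro retraction_carrier) auto
      ultimately show ?thesis using xB by (simp add: B_def)
    next
      case 2
      then have "retraction x = []" by (simp add: retraction_def retract_def reduce_def)
      then show ?thesis using w.S.one_closed by (simp add: one_free_group)
    qed
  qed
  then have "relators f \<subseteq> {x \<in> carrier Fk. retraction x \<in> ?M}"
    using relators_carrier[OF f] by blast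
  then have "kern f \<subseteq> {x \<in> carrier Fk. retraction x \<in> ?M}"
    using N unfolding normal_closure_def by blast
  then have "retraction w \<in> ?M" using w by blast
  then have "w \<in> ?M" using retraction_carrier w by simp
  then show "w \<in> B" "pair_sum (coset_weight S) w = 0" by (auto simp: B_def)
qed

end

end

text \<open>The counterpart of \<open>B\<close> in any group. It refers to no presentation, so
  epimorphisms carry it along.\<close>

definition layer :: "nat \<Rightarrow> ('a, 'b) monoid_scheme \<Rightarrow> 'a set" where
  "layer q G = squares G (squares G (power_comm q G))"

lemma (in group) layer_normal: "layer q G \<lhd> G"
  unfolding layer_def by (intro squares_normal power_comm_normal)

context mod_q
begin

lemma image_B:
  assumes "group_hom F G \<alpha>" "\<alpha> ` carrier F = carrier G"
  shows "\<alpha> ` B = layer q G" "\<alpha> ` V = central_squares G (layer q G)"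
proof -
  interpret group_hom F G \<alpha> by fact
  show B: "\<alpha> ` B = layer q G"
    unfolding layer_def B_def A_def K_def
    using K.subset A.subset
    by (simp add: power_comm_img[OF assms(2)] squares_img flip: A_def K_def)
  show "\<alpha> ` V = central_squares G (layer q G)"
    unfolding V_def B[symmetric] by (rule central_squares_img[OF assms(2) B.subset, symmetric])
qed

lemma B_subset_squares: "B \<subseteq> squares F (carrier F)"
  unfolding B_def by (rule F.squares_mono[OF A.subset])

end

section \<open>Recovering a family from its group\<close>

context relator_family
begin

text \<open>Agreement of the two epimorphisms on generators modulo \<open>layer\<close> gives
  agreement on \<open>B\<close> modulo the image of \<open>V\<close>. Hence a relator of
  \<open>f\<close> lies in the kernel for \<open>g\<close> up to \<open>V\<close>. If
  \<open>f x\<close> and \<open>g x\<close> differ at y, the pair sum that vanishes on the relators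
  of \<open>g\<close> and on \<open>V\<close> is 1 on the relator of \<open>f\<close> at x.\<close>

lemma family_determined:
  assumes f: "f \<in> families" and g: "g \<in> families"
    and \<theta>: "\<theta> \<in> iso (presented f) G" and \<eta>: "\<eta> \<in> iso (presented g) G" and G: "group G"
    and agree: "\<And>i. i \<in> {1..2} \<Longrightarrow>
      inv\<^bsub>G\<^esub> (\<theta> (proj f [(i, True)])) \<otimes>\<^bsub>G\<^esub> \<eta> (proj g [(i, True)]) \<in> layer q G"
  shows "f = g"
proof -
  interpret G: group G by fact
  let ?\<alpha> = "\<lambda>w. \<theta> (proj f w)" and ?\<beta> = "\<lambda>w. \<eta> (proj g w)"
  have hom: "group_hom F G (\<lambda>w. \<phi> (proj h w))" "(\<lambda>w. \<phi> (proj h w)) ` carrier F = carrier G"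
    if "h \<in> families" "\<phi> \<in> iso (presented h) G" for h \<phi>
  proof -
    interpret h: group_hom F "presented h" "proj h" by (rule proj_hom) fact
    have "\<phi> \<circ> proj h \<in> hom F G"
      using h.homh that(2) by (intro hom_compose) (auto simp: iso_def)
    then show "group_hom F G (\<lambda>w. \<phi> (proj h w))"
      by (simp add: group_hom_def group_hom_axioms_def group_free_group G comp_def)
    have "(\<lambda>w. \<phi> (proj h w)) ` carrier F = \<phi> ` proj h ` carrier F" by (simp add: image_image)
    then show "(\<lambda>w. \<phi> (proj h w)) ` carrier F = carrier G"
      using proj_surj[OF that(1)] that(2) by (auto simp: iso_def bij_betw_def)
  qed
  note \<alpha> = hom[OF f \<theta>] and \<beta> = hom[OF g \<eta>]
  have "carrier F \<subseteq> {x \<in> carrier F. inv\<^bsub>G\<^esub> (?\<alpha> x) \<otimes>\<^bsub>G\<^esub> ?\<beta> x \<in> layer q G}"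
    by (rule free_group_generated[OF hom_agree_subgroup[OF \<alpha>(1) \<beta>(1) G.layer_normal]])
      (use agree in \<open>auto simp: carrier_free_group reduced_def\<close>)
  then have agree': "inv\<^bsub>G\<^esub> (?\<alpha> w) \<otimes>\<^bsub>G\<^esub> ?\<beta> w \<in> central_squares G (layer q G)" if "w \<in> B" for w
    using that B_subset_squares by (intro hom_agree_on_squares[OF \<alpha>(1) \<beta>(1) G.layer_normal]) blast+
  have "f x = g x" if x: "x \<in> C" for x
  proof (rule ccontr)
    assume neq: "f x \<noteq> g x"
    have fg: "f x \<subseteq> D" "g x \<subseteq> D" using f g x by (auto simp: families_def)
    with neq obtain y where y: "y \<in> D" "y \<in> f x \<longleftrightarrow> y \<notin> g x" by blast
    let ?w = "relator x (f x)"
    let ?S = "insert y {z \<in> C. y \<in> g z}"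
    interpret w: invariant_weight "coset_weight ?S" 2 A by (rule coset_weight_invariant)
    have wB: "?w \<in> B" by (rule relator_in_B[OF x fg(1)])
    have wF: "?w \<in> carrier F" using wB by auto
    have "?w \<in> kern f" using relators_kern[OF f] x by (auto simp: relators_def)
    then have "proj f ?w = \<one>\<^bsub>presented f\<^esub>"
      using Fk.coset_join2[OF subsetD[OF F_subset_Fk wF] normal_imp_subgroup[OF kern_normal[OF f]]]
      by (simp add: proj_def presented_group_def)
    then have "?\<alpha> ?w = \<one>\<^bsub>G\<^esub>"
      using \<theta> group_presented_group[OF relators_carrier[OF f]] G
      by (simp add: iso_def hom_one)
    then have "?\<beta> ?w \<in> central_squares G (layer q G)"
      using agree'[OF wB] group_hom.hom_closed[OF \<beta>(1) wF] by simp
    \<comment> \<open>The epimorphism maps \<open>V\<close> onto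
      \<open>central_squares G (layer q G)\<close>; injectivity of \<open>\<eta>\<close> then puts
      the quotient of the relator by \<open>v\<close> into \<open>kern g\<close>.\<close>
    then obtain v where v: "v \<in> V" "?\<beta> ?w = ?\<beta> v"
      using image_B(2)[OF \<beta>] by auto
    have vF: "v \<in> carrier F" using v by auto
    have inj: "inj_on \<eta> (carrier (presented g))" using \<eta> by (auto simp: iso_def bij_betw_def)
    have "proj g v = proj g ?w"
      using inj_onD[OF inj v(2)[symmetric]] group_hom.hom_closed[OF proj_hom[OF g]] vF wF by blast
    then have "inv\<^bsub>Fk\<^esub> v \<otimes>\<^bsub>Fk\<^esub> ?w \<in> kern g"
      using Fk.rcos_eq_iff[OF kern_normal[OF g]] vF wF F_subset_Fk by (auto simp: proj_def)
    moreover have "inv\<^bsub>Fk\<^esub> v = inv\<^bsub>F\<^esub> v"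
      using vF F_subset_Fk by (auto simp: inv_free_group)
    ultimately have kern: "inv\<^bsub>F\<^esub> v \<otimes>\<^bsub>F\<^esub> ?w \<in> kern g" by (simp add: mult_free_group)
    have vS: "v \<in> w.S" "pair_sum (coset_weight ?S) v = 0"
      using w.central_squares_pair_sum[of v] v(1) unfolding V_def B_def by auto
    have "pair_sum (coset_weight ?S) (inv\<^bsub>F\<^esub> v \<otimes>\<^bsub>F\<^esub> ?w) = 0"
      using kern_pair_sum(2)[OF g y(1) kern] vF wF by simp
    then have "pair_sum (coset_weight ?S) ?w = 0"
      using vS vF wF by (subst (asm) w.pair_sum_mult) (auto simp: w.pair_sum_inv)
    moreover have "pair_sum (coset_weight ?S) ?w = of_bool (x \<in> ?S) + of_bool (y \<in> f x)"
      by (rule pair_sum_relator[OF x fg(1)]) (use CD y in auto)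
    moreover have "x \<in> ?S \<longleftrightarrow> y \<in> g x" using x y CD by auto
    ultimately show False using y(2) by (auto split: if_splits)
  qed
  then show ?thesis
    using f g unfolding families_def by (intro PiE_ext) auto
qed

section \<open>Counting the families of one isomorphism type\<close>

definition short_words :: "letter list set" where
  "short_words = {w. word 2 w \<and> length w \<le> 4 * index_A}"

lemma card_short_words: "card short_words \<le> 4 ^ (4 * index_A + 1)"
proof -
  let ?L = "{1..2::nat} \<times> (UNIV :: bool set)"
  have "card short_words = (\<Sum>i\<le>4 * index_A. card ?L ^ i)"
    unfolding short_words_def word_def by (rule card_lists_length_le) simp
  also have "\<dots> = (\<Sum>i\<le>4 * index_A. 4 ^ i)" by (simp add: card_cartesian_product)
  also have "\<dots> \<le> 4 ^ (4 * index_A + 1)"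
  proof -
    have "(\<Sum>i\<le>n. 4 ^ i) \<le> (4::nat) ^ (n + 1)" for n by (induction n) auto
    then show ?thesis .
  qed
  finally show ?thesis .
qed

text \<open>An isomorphism to the fixed group is recorded by two short words, which represent the
  images of the two generators modulo \<open>layer\<close>. By \<open>family_determined\<close> they
  determine the family.\<close>

lemma card_isomorphic_families:
  assumes g: "g \<in> families"
  shows "card {f \<in> families. presented f \<cong> presented g} \<le> card short_words ^ 2"
proof -
  let ?G = "presented g"
  have G: "group ?G" by (rule group_presented_group[OF relators_carrier[OF g]])
  interpret G: group ?G by fact
  interpret L: normal "layer q ?G" ?G by (rule G.layer_normal)
  define \<theta> where "\<theta> f = (SOME \<theta>. \<theta> \<in> iso (presented f) ?G)" for f
  define code where "code f i = (SOME w. w \<in> short_words \<and>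
      inv\<^bsub>?G\<^esub> (proj g (reduce w)) \<otimes>\<^bsub>?G\<^esub> \<theta> f (proj f [(i, True)]) \<in> layer q ?G)" for f i
  let ?I = "{f \<in> families. presented f \<cong> presented g}"
  have \<theta>: "\<theta> f \<in> iso (presented f) ?G" if "f \<in> ?I" for f
    using that someI_ex[of "\<lambda>\<theta>. \<theta> \<in> iso (presented f) ?G"] by (auto simp: \<theta>_def is_iso_def)
  have closed: "\<theta> f (proj f [(i, True)]) \<in> carrier ?G" if "f \<in> ?I" "i \<in> {1..2}" for f i
  proof -
    have "[(i, True)] \<in> carrier F" using that by (auto simp: carrier_free_group reduced_def)
    then have "proj f [(i, True)] \<in> carrier (presented f)"
      using that by (intro group_hom.hom_closed[OF proj_hom]) auto
    then show ?thesis using \<theta>[OF that(1)] by (auto simp: iso_def hom_def)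
  qed
  have code: "code f i \<in> short_words"
      "inv\<^bsub>?G\<^esub> (proj g (reduce (code f i))) \<otimes>\<^bsub>?G\<^esub> \<theta> f (proj f [(i, True)]) \<in> layer q ?G"
    if fi: "f \<in> ?I" "i \<in> {1..2}" for f i
  proof -
    interpret p: group_hom F ?G "proj g" by (rule proj_hom[OF g])
    obtain u where u: "u \<in> carrier F" "\<theta> f (proj f [(i, True)]) = proj g u"
      using closed[OF fi] proj_surj[OF g] by (metis imageE)
    then obtain w where w: "word 2 w" "length w \<le> 4 * index_A" "inv\<^bsub>F\<^esub> (reduce w) \<otimes>\<^bsub>F\<^esub> u \<in> B"
      using short_rep_B[of u] by (auto simp: word_carrier reduce_carrier)
    then have "proj g (inv\<^bsub>F\<^esub> (reduce w) \<otimes>\<^bsub>F\<^esub> u) \<in> layer q ?G"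
      using image_B(1)[OF proj_hom[OF g] proj_surj[OF g]] by blast
    then have "inv\<^bsub>?G\<^esub> (proj g (reduce w)) \<otimes>\<^bsub>?G\<^esub> \<theta> f (proj f [(i, True)]) \<in> layer q ?G"
      using u reduce_in_carrier[OF w(1)] by simp
    then have "\<exists>w. w \<in> short_words \<and>
      inv\<^bsub>?G\<^esub> (proj g (reduce w)) \<otimes>\<^bsub>?G\<^esub> \<theta> f (proj f [(i, True)]) \<in> layer q ?G"
      using w by (auto simp: short_words_def)
    from someI_ex[OF this] show "code f i \<in> short_words"
      "inv\<^bsub>?G\<^esub> (proj g (reduce (code f i))) \<otimes>\<^bsub>?G\<^esub> \<theta> f (proj f [(i, True)]) \<in> layer q ?G"
      by (auto simp: code_def)
  qed
  have "inj_on (\<lambda>f. (code f 1, code f 2)) ?I"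
  proof (rule inj_onI)
    fix f h assume fh: "f \<in> ?I" "h \<in> ?I" and eq: "(code f 1, code f 2) = (code h 1, code h 2)"
    show "f = h"
    proof (rule family_determined[OF _ _ \<theta>[OF fh(1)] \<theta>[OF fh(2)] G])
      fix i :: nat assume i: "i \<in> {1..2}"
      then have "i = 1 \<or> i = 2" by auto
      then have ci: "code f i = code h i" using eq by auto
      interpret p: group_hom F ?G "proj g" by (rule proj_hom[OF g])
      have "proj g (reduce (code h i)) \<in> carrier ?G"
        using code(1)[OF fh(2) i] by (auto simp: short_words_def intro!: p.hom_closed reduce_in_carrier)
      moreover have "inv\<^bsub>?G\<^esub> (inv\<^bsub>?G\<^esub> (proj g (reduce (code h i))) \<otimes>\<^bsub>?G\<^esub> \<theta> f (proj f [(i, True)])) \<otimes>\<^bsub>?G\<^esub>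
          (inv\<^bsub>?G\<^esub> (proj g (reduce (code h i))) \<otimes>\<^bsub>?G\<^esub> \<theta> h (proj h [(i, True)])) \<in> layer q ?G"
        using code(2)[OF fh(1) i] code(2)[OF fh(2) i] unfolding ci
        by (rule L.m_closed[OF L.m_inv_closed])
      ultimately show "inv\<^bsub>?G\<^esub> (\<theta> f (proj f [(i, True)])) \<otimes>\<^bsub>?G\<^esub> \<theta> h (proj h [(i, True)]) \<in> layer q ?G"
        using closed[OF fh(1) i] closed[OF fh(2) i] by (simp add: G.inv_mult_group G.m_assoc)
    qed (use fh in auto)
  qed
  then have "card ?I \<le> card (short_words \<times> short_words)"
    by (rule card_inj_on_le) (use code in \<open>auto simp: short_words_def finite_words\<close>)
  then show ?thesis by (simp add: card_cartesian_product power2_eq_square)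
qed

lemma card_families: "card families = (card D choose t) ^ card C"
proof -
  have "card families = (\<Prod>x\<in>C. card {T. T \<subseteq> D \<and> card T = t})"
    unfolding families_def by (rule card_PiE[OF finite_CD(1)])
  then show ?thesis by (simp add: n_subsets[OF finite_CD(2)])
qed

text \<open>Families are sent to the isomorphism classes of their groups, and
  \<open>card_isomorphic_families\<close> bounds the fibres.\<close>

lemma card_families_le:
  assumes n: "(t + 1) * (24 * q\<^sup>2) \<le> n"
  shows "(card D choose t) ^ card C \<le> num_iso_types k n * (4 ^ (4 * index_A + 1))\<^sup>2"
proof -
  let ?\<G> = "{presented_group k R | R. R \<subseteq> free_ball k n}"
  let ?r = "{(G, H). G \<in> ?\<G> \<and> H \<in> ?\<G> \<and> G \<cong> H}"
  define cl where "cl f = ?r `` {presented f}" for f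
  have mem: "presented f \<in> ?\<G>" if "f \<in> families" for f
    using relators_free_ball[OF that n] by blast
  have finD: "finite {T. T \<subseteq> D \<and> card T = t}" using finite_CD(2) by simp
  have fin: "finite families"
    unfolding families_def using finite_CD(1) finD by (intro finite_PiE) auto
  have fiber: "card {f \<in> families. cl f = c} \<le> (4 ^ (4 * index_A + 1))\<^sup>2" for c
  proof (cases "\<exists>g \<in> families. cl g = c")
    case True
    then obtain g where g: "g \<in> families" "cl g = c" by blast
    have "{f \<in> families. cl f = c} \<subseteq> {f \<in> families. presented f \<cong> presented g}"
    proof safe
      fix f assume f: "f \<in> families" "c = cl f"
      have "presented g \<in> cl g" using mem[OF g(1)] iso_refl by (auto simp: cl_def)
      then have "presented g \<in> cl f" using g f by simp
      then show "presented f \<cong> presented g" by (auto simp: cl_def)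
    qed
    then have "card {f \<in> families. cl f = c} \<le> card {f \<in> families. presented f \<cong> presented g}"
      by (rule card_mono[rotated]) (use fin in simp)
    also have "\<dots> \<le> card short_words ^ 2" by (rule card_isomorphic_families[OF g(1)])
    also have "\<dots> \<le> (4 ^ (4 * index_A + 1))\<^sup>2" by (rule power_mono[OF card_short_words]) simp
    finally show ?thesis .
  next
    case False
    then have "{f \<in> families. cl f = c} = {}" by blast
    then show ?thesis by (simp only: card.empty)
  qed
  have "families = (\<Union>c\<in>cl ` families. {f \<in> families. cl f = c})" by blast
  then have "card families = card (\<Union>c\<in>cl ` families. {f \<in> families. cl f = c})" by simp
  also have "\<dots> \<le> (\<Sum>c\<in>cl ` families. card {f \<in> families. cl f = c})"
    using fin by (intro card_UN_le) simp
  also have "\<dots> \<le> card (cl ` families) * (4 ^ (4 * index_A + 1))\<^sup>2"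
    using sum_bounded_above[of "cl ` families" "\<lambda>c. card {f \<in> families. cl f = c}", OF fiber] by simp
  also have "card (cl ` families) \<le> num_iso_types k n"
    unfolding num_iso_types_def
  proof (rule card_mono[OF finite_iso_types])
    show "cl ` families \<subseteq> iso_types ?\<G>"
      unfolding iso_types_def
    proof (rule image_subsetI)
      fix f assume "f \<in> families"
      then show "cl f \<in> ?\<G> // ?r" unfolding cl_def by (intro quotientI mem)
    qed
  qed
  finally show ?thesis by (simp add: card_families mult_right_mono)
qed

end

context mod_q
begin

lemma num_iso_types_bound:
  assumes k: "k \<ge> 2" and n: "(t + 1) * (24 * q\<^sup>2) \<le> n"
  obtains d where "index_A \<le> (2 * d + 1) * (2 * q)\<^sup>2"
    "(d choose t) ^ d \<le> num_iso_types k n * (4 ^ (4 * index_A + 1))\<^sup>2"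
proof -
  obtain E where E: "E \<subseteq> carrier (F Mod A)" "index_A \<le> card E * (2 * q)\<^sup>2"
    "\<And>c g. c \<in> E \<Longrightarrow> g \<in> E \<Longrightarrow> g \<in> reach c \<Longrightarrow> c = g"
    by (rule independent_cosets) blast
  have fin: "finite E" using E(1) finite_quotient_A by (rule finite_subset)
  \<comment> \<open>Rounding down loses at most one coset, whence \<open>2 * d + 1\<close> in the
    bound.\<close>
  define d where "d = card E div 2"
  obtain C where C: "C \<subseteq> E" "card C = d"
    using obtain_subset_with_card_n[of d E] by (auto simp: d_def)
  have "d \<le> card (E - C)" using C fin by (simp add: card_Diff_subset finite_subset d_def)
  then obtain D where D: "D \<subseteq> E - C" "card D = d" using obtain_subset_with_card_n by metis
  interpret relator_family q k t C D
    by unfold_locales (use k C D E in blast)+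
  have "card E \<le> 2 * d + 1" by (simp add: d_def)
  then have "index_A \<le> (2 * d + 1) * (2 * q)\<^sup>2" using E(2) by (meson le_trans mult_le_mono1)
  then show ?thesis using that[of d] card_families_le[OF n] C D by simp
qed

end

section \<open>The double exponential bound\<close>

text \<open>Here t = 1008. The index M is at most 12 q^2 d, and \<open>large\<close> makes the
  binomial coefficient at least 2^(1008 q^2 / 4) = 2^(252 q^2). As 252 = 21 * 12, its d-th power is
  at least 2^(21 M). The fibres have at most 2^(16 M + 4) elements, which is at most 2^(20 M), so at
  least 2^M types remain.\<close>

lemma num_iso_types_ge:
  assumes q: "q \<ge> 1" and k: "k \<ge> 2" and n: "1009 * (24 * q\<^sup>2) \<le> n"
    and large: "12 * real q ^ 2 * (1008 * 2 powr (real q ^ 2 / 4)) \<le> 2 powr (real q ^ 2 - real q)"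
  shows "2 powr (2 powr (real q ^ 2 - real q)) \<le> real (num_iso_types k n)"
proof -
  interpret mod_q q by unfold_locales (fact q)
  define M where "M = index_A"
  have "2 powr (real q ^ 2 - real q) = real (2 ^ ((q - 1) * q))"
    using q by (simp add: powr_realpow[symmetric] of_nat_diff power2_eq_square algebra_simps)
  also have "\<dots> \<le> real M" unfolding M_def using index_A_ge by (rule of_nat_mono)
  finally have M: "2 powr (real q ^ 2 - real q) \<le> real M" .
  obtain d where d: "M \<le> (2 * d + 1) * (2 * q)\<^sup>2"
    "(d choose 1008) ^ d \<le> num_iso_types k n * (4 ^ (4 * M + 1))\<^sup>2"
    unfolding M_def by (rule num_iso_types_bound[OF k, of 1008 n]) (use n in auto)
  have one: "1 \<le> 2 powr (real q ^ 2 / 4)" by (simp add: ge_one_powr_ge_zero)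
  have q2: "0 < real q ^ 2" using q by simp
  \<comment> \<open>For \<open>d = 0\<close> the index would be at most 4 q^2, against
    \<open>large\<close>. Positivity allows \<open>2 * d + 1\<close> to be bounded by
    \<open>3 * d\<close>.\<close>
  have d1: "d \<ge> 1"
  proof (rule ccontr)
    assume "\<not> d \<ge> 1"
    then have "d = 0" by simp
    then have "M \<le> 4 * q\<^sup>2" using d(1) by (simp add: power_mult_distrib)
    then have "real M \<le> 4 * real q ^ 2" by (metis of_nat_le_iff of_nat_mult of_nat_numeral of_nat_power)
    also have "\<dots> < 12 * real q ^ 2 * (1008 * 1)" using q2 by simp
    also have "\<dots> \<le> 12 * real q ^ 2 * (1008 * 2 powr (real q ^ 2 / 4))"
      using one q2 by (intro mult_left_mono) auto
    also have "\<dots> \<le> real M" using large M by linarith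
    finally show False by simp
  qed
  have "real M \<le> (2 * real d + 1) * (4 * real q ^ 2)"
    using of_nat_mono[OF d(1), where 'a = real] by (simp add: power_mult_distrib algebra_simps)
  also have "\<dots> \<le> (3 * real d) * (4 * real q ^ 2)"
    using d1 by (intro mult_right_mono) auto
  also have "\<dots> = 12 * (real d * real q ^ 2)" by simp
  also have "\<dots> = 12 * real q ^ 2 * real d" by (simp only: mult.assoc mult.commute[of "real d"])
  finally have Md: "real M \<le> 12 * real q ^ 2 * real d" .
  have "12 * real q ^ 2 * (1008 * 2 powr (real q ^ 2 / 4)) \<le> 12 * real q ^ 2 * real d"
    using large M Md by linarith
  then have dt: "1008 * 2 powr (real q ^ 2 / 4) \<le> real d" using q2 by simp
  then have "1008 \<le> d" using one by linarith
  then have "(real d / real 1008) ^ 1008 \<le> real (d choose 1008)"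
    by (rule binomial_ge_n_over_k_pow_k)
  moreover have "(2 powr (real q ^ 2 / 4)) ^ 1008 \<le> (real d / real 1008) ^ 1008"
    by (rule power_mono) (use dt in simp_all)
  moreover have "(2 powr (real q ^ 2 / 4)) ^ 1008 = 2 powr (252 * real q ^ 2)"
    by (simp add: powr_power)
  ultimately have choose: "2 powr (252 * real q ^ 2) \<le> real (d choose 1008)" by linarith
  have "2 powr (21 * real M) \<le> 2 powr (252 * real q ^ 2 * real d)"
    by (rule powr_mono) (use Md in linarith, simp)
  also have "\<dots> = (2 powr (252 * real q ^ 2)) ^ d" by (simp add: powr_power mult.commute)
  also have "\<dots> \<le> real (d choose 1008) ^ d" using choose by (rule power_mono) simp
  also have "\<dots> \<le> real (num_iso_types k n) * (4 ^ (4 * M + 1))\<^sup>2"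
    using of_nat_mono[OF d(2), where 'a = real] by simp
  also have "(4 ^ (4 * M + 1))\<^sup>2 = (2 powr (16 * real M + 4) :: real)"
  proof -
    have "(4 ^ (4 * M + 1))\<^sup>2 = (2 :: real) ^ (2 * (4 * M + 1) * 2)"
      by (simp only: power_mult) simp
    also have "\<dots> = 2 powr real (2 * (4 * M + 1) * 2)" by (rule powr_realpow[symmetric]) simp
    also have "real (2 * (4 * M + 1) * 2) = 16 * real M + 4" by simp
    finally show ?thesis .
  qed
  also have "real (num_iso_types k n) * 2 powr (16 * real M + 4) \<le> real (num_iso_types k n) * 2 powr (20 * real M)"
  proof (intro mult_left_mono powr_mono)
    have "0 < real M" using M by (rule less_le_trans[rotated]) simp
    then show "16 * real M + 4 \<le> 20 * real M" by simp
  qed auto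
  finally have "2 powr (21 * real M) / 2 powr (20 * real M) \<le> real (num_iso_types k n)"
    by (simp add: divide_simps)
  then have "2 powr real M \<le> real (num_iso_types k n)" by (simp flip: powr_diff)
  moreover have "2 powr (2 powr (real q ^ 2 - real q)) \<le> 2 powr real M"
    using M by (intro powr_mono) auto
  ultimately show ?thesis by linarith
qed

lemma double_exponential:
  assumes k: "k \<ge> 2"
  shows "\<exists>\<rho>::real. \<rho> > 1 \<and> (\<forall>\<^sub>F n in sequentially. real (num_iso_types k n) \<ge> \<rho> powr (\<rho> ^ n))"
proof (intro exI conjI)
  define c :: real where "c = 1009 * 24"
  \<comment> \<open>The factor 2 in the denominator absorbs the term -q in q^2 - q and the rounding
    in \<open>Q\<close>.\<close>
  define \<rho> :: real where "\<rho> = 2 powr (1 / (2 * c))"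
  \<comment> \<open>The largest q for which the relators, of length at most c q^2, fit into the ball
    of radius n.\<close>
  define Q where "Q n = nat \<lfloor>sqrt (real n / c)\<rfloor>" for n
  show \<rho>: "\<rho> > 1" unfolding \<rho>_def c_def by (simp add: gr_one_powr)
  have "\<forall>\<^sub>F q in sequentially. q \<ge> 1 \<and>
      12 * real q ^ 2 * (1008 * 2 powr (real q ^ 2 / 4)) \<le> 2 powr (real q ^ 2 - real q)"
    by (intro eventually_conj eventually_ge_at_top) real_asymp
  moreover have "filterlim Q sequentially sequentially"
    unfolding Q_def c_def by real_asymp
  ultimately have "\<forall>\<^sub>F n in sequentially. Q n \<ge> 1 \<and>
      12 * real (Q n) ^ 2 * (1008 * 2 powr (real (Q n) ^ 2 / 4)) \<le> 2 powr (real (Q n) ^ 2 - real (Q n))"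
    by (rule eventually_compose_filterlim)
  moreover have "\<forall>\<^sub>F n in sequentially. sqrt (real n / c) \<ge> 6"
    unfolding c_def by real_asymp
  ultimately show "\<forall>\<^sub>F n in sequentially. real (num_iso_types k n) \<ge> \<rho> powr (\<rho> ^ n)"
  proof eventually_elim
    case (elim n)
    let ?q = "Q n" and ?s = "sqrt (real n / c)"
    have qs: "real ?q \<le> ?s" "?s - 1 \<le> real ?q"
      unfolding Q_def using elim(2) by linarith+
    have "real ?q ^ 2 \<le> ?s ^ 2" using qs by (intro power_mono) auto
    also have "?s ^ 2 = real n / c" by (simp add: c_def)
    finally have "real (1009 * (24 * ?q\<^sup>2)) \<le> real n" by (simp add: c_def)
    then have "1009 * (24 * ?q\<^sup>2) \<le> n" by (simp only: of_nat_le_iff)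
    then have *: "2 powr (2 powr (real ?q ^ 2 - real ?q)) \<le> real (num_iso_types k n)"
      using elim(1) by (intro num_iso_types_ge k) auto
    have "0 \<le> ?s" using elim(2) by linarith
    \<comment> \<open>This is where 6 comes from: s (s - 6) \<ge> 0 gives s^2 / 2 \<le> (s - 1) (s -
      2), and \<open>Q n\<close> is at least s - 1.\<close>
    then have "0 \<le> ?s * (?s - 6)" using elim(2) by (intro mult_nonneg_nonneg) linarith+
    then have "?s ^ 2 / 2 \<le> (?s - 1) * (?s - 2)" by (simp add: power2_eq_square algebra_simps)
    then have "real n / (2 * c) \<le> (?s - 1) * (?s - 2)" by (simp add: c_def)
    also have "(?s - 1) * (?s - 2) \<le> real ?q * (real ?q - 1)"
      using qs elim(2) by (intro mult_mono) auto
    finally have exponent: "real n / (2 * c) \<le> real ?q ^ 2 - real ?q"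
      by (simp add: power2_eq_square algebra_simps)
    have "\<rho> ^ n = 2 powr (real n / (2 * c))" by (simp add: \<rho>_def powr_power)
    also have "\<dots> \<le> 2 powr (real ?q ^ 2 - real ?q)" using exponent by (intro powr_mono) auto
    finally have "2 powr (\<rho> ^ n) \<le> 2 powr (2 powr (real ?q ^ 2 - real ?q))" by (intro powr_mono) auto
    moreover have "\<rho> powr (\<rho> ^ n) \<le> 2 powr (\<rho> ^ n)"
    proof (rule powr_mono2)
      have "\<rho> \<le> 2 powr 1" unfolding \<rho>_def c_def by (intro powr_mono) auto
      then show "\<rho> \<le> 2" by simp
    qed (use \<rho> in auto)
    ultimately show ?case using * by linarith
  qed
qed

theorem corollary1p4:
  shows "(\<exists>\<rho>::real. \<rho> > 1 \<and> (\<forall>\<^sub>F n in sequentially. real (num_iso_types 2 n) \<ge> \<rho> powr (\<rho> ^ n))) \<and>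
         (\<forall>k::nat. k \<ge> 2 \<longrightarrow>
            (\<exists>\<rho>::real. \<rho> > 1 \<and> (\<forall>\<^sub>F n in sequentially. real (num_iso_types k n) \<ge> \<rho> powr (\<rho> ^ n))))"
  using double_exponential by blast

end
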